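(* There are absolute constants $c>0$ and $a\ge0$ such that for all positive integers $N\ge2,S,G$ there is a formula of depth at most 3 on $N$ input variables, with formula size at most $S$ and at most $G$ gates, computing a function $f$ with $Q(f)\ge c\min\{N,\sqrt{S},N^{1/2}G^{1/4}\}/\log^a N$.
   Context: A formula on input variables is a rooted tree whose leaves are labeled by input variables (the same variable may label many leaves) and whose internal vertices are \textsc{not} gates (fanin 1) or unbounded-fanin \textsc{and}/\textsc{or} gates. The formula size is the number of leaves; the gate count is the number of \textsc{and} and \textsc{or} gates; the depth is the length of a longest root-to-leaf path (counting \textsc{and}/\textsc{or} levels; \textsc{not} gates may be assumed to be applied only to inputs). $Q(f)$ denotes bounded-error quantum query complexity (error at most $1/3$ on every input, queries via $|i,b\rangle\mapsto|i,b\oplus x_i\rangle$). *)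

theory Defs
  imports Complex_Main
begin

datatype form = Lit nat bool
  | AndF "form list" | OrF "form list"

fun feval :: "form \<Rightarrow> (nat \<Rightarrow> bool) \<Rightarrow> bool" where
  "feval (Lit i p) x = (x i = p)"
| "feval (AndF fs) x = (\<forall>g\<in>set fs. feval g x)"
| "feval (OrF fs) x = (\<exists>g\<in>set fs. feval g x)"

fun fsize :: "form \<Rightarrow> nat" where
  "fsize (Lit i p) = 1"
| "fsize (AndF fs) = sum_list (map fsize fs)"
| "fsize (OrF fs) = sum_list (map fsize fs)"

fun fgates :: "form \<Rightarrow> nat" where
  "fgates (Lit i p) = 0"
| "fgates (AndF fs) = Suc (sum_list (map fgates fs))"
| "fgates (OrF fs) = Suc (sum_list (map fgates fs))"

fun fdepth :: "form \<Rightarrow> nat" where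
  "fdepth (Lit i p) = 0"
| "fdepth (AndF fs) = Suc (fold max (map fdepth fs) 0)"
| "fdepth (OrF fs) = Suc (fold max (map fdepth fs) 0)"

fun fvars :: "form \<Rightarrow> nat set" where
  "fvars (Lit i p) = {i}"
| "fvars (AndF fs) = (\<Union>g\<in>set fs. fvars g)"
| "fvars (OrF fs) = (\<Union>g\<in>set fs. fvars g)"

text \<open>State space of dimension D = 2*N*m with computational basis |i,b,w>,
  i < N (query index), b in {0,1} (answer bit), w < m (workspace); basis index
  k encodes i = k mod N, b = (k div N) mod 2, w = k div (2*N).
  Vectors are functions nat => complex (only indices < D matter), matrices
  are functions nat => nat => complex.\<close>

definition unitary :: "nat \<Rightarrow> (nat \<Rightarrow> nat \<Rightarrow> complex) \<Rightarrow> bool" where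
  "unitary D U \<longleftrightarrow> (\<forall>j<D. \<forall>k<D.
      (\<Sum>l<D. cnj (U l j) * U l k) = (if j = k then 1 else 0))"

definition apply_mat :: "nat \<Rightarrow> (nat \<Rightarrow> nat \<Rightarrow> complex) \<Rightarrow> (nat \<Rightarrow> complex) \<Rightarrow> (nat \<Rightarrow> complex)" where
  "apply_mat D U v = (\<lambda>j. \<Sum>k<D. U j k * v k)"

text \<open>the oracle operator |i,b,w> |-> |i, b XOR x_i, w> (a permutation of basis states,
  an involution)\<close>
definition flip_index :: "nat \<Rightarrow> (nat \<Rightarrow> bool) \<Rightarrow> nat \<Rightarrow> nat" where
  "flip_index N x k = (if x (k mod N) then
      (if (k div N) mod 2 = 0 then k + N else k - N) else k)"

definition query_op :: "nat \<Rightarrow> (nat \<Rightarrow> bool) \<Rightarrow> (nat \<Rightarrow> complex) \<Rightarrow> (nat \<Rightarrow> complex)" where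
  "query_op N x v = (\<lambda>k. v (flip_index N x k))"

fun run :: "nat \<Rightarrow> nat \<Rightarrow> (nat \<Rightarrow> bool) \<Rightarrow> (nat \<Rightarrow> nat \<Rightarrow> complex) list
             \<Rightarrow> (nat \<Rightarrow> complex) \<Rightarrow> (nat \<Rightarrow> complex)" where
  "run N D x [] v = v"
| "run N D x [U] v = apply_mat D U v"
| "run N D x (U # V # Us) v = run N D x (V # Us) (query_op N x (apply_mat D U v))"

definition init_state :: "nat \<Rightarrow> complex" where
  "init_state = (\<lambda>k. if k = 0 then 1 else 0)"

definition accept_prob :: "nat \<Rightarrow> nat \<Rightarrow> (nat \<Rightarrow> nat \<Rightarrow> complex) list \<Rightarrow> nat set
      \<Rightarrow> (nat \<Rightarrow> bool) \<Rightarrow> real" where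
  "accept_prob N m Us A x =
     (\<Sum>k\<in>A. (cmod (run N (2*N*m) x Us init_state k))\<^sup>2)"

text \<open>f : {0,1}^N -> {0,1} (inputs x :: nat => bool, only x_0..x_{N-1} are
  queried) is computed with error at most 1/3 on every input by a T-query algorithm\<close>
definition bounded_error_alg :: "nat \<Rightarrow> ((nat \<Rightarrow> bool) \<Rightarrow> bool) \<Rightarrow> nat \<Rightarrow> bool" where
  "bounded_error_alg N f T \<longleftrightarrow>
     (\<exists>m>0. \<exists>Us A. length Us = Suc T \<and> (\<forall>U\<in>set Us. unitary (2*N*m) U)
        \<and> A \<subseteq> {..<2*N*m}
        \<and> (\<forall>x. (f x \<longrightarrow> accept_prob N m Us A x \<ge> 2/3)
              \<and> (\<not> f x \<longrightarrow> accept_prob N m Us A x \<le> 1/3)))"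

definition Q :: "nat \<Rightarrow> ((nat \<Rightarrow> bool) \<Rightarrow> bool) \<Rightarrow> nat" where
  "Q N f = (LEAST T. bounded_error_alg N f T)"

end

theory Submission
  imports Defs "HOL-Library.FuncSet"
begin

text \<open>The hard function asks whether every label from 1 to \<open>n\<close> occurs among \<open>2 * n - 1\<close> positions, each of
  which holds a label or is unlabelled. On inputs where no label occurs twice, this amounts to telling
  \<open>n\<close> labelled positions from \<open>n - 1\<close>, which takes about \<open>n\<close> queries to positions: related inputs
  differ at one position, and each input is related to at least \<open>n\<close> others. The label at a
  position is moreover hidden in one of \<open>K\<close> cells, which costs a further factor of \<open>sqrt K\<close>, and
  Ambainis' adversary method captures both factors at once. The test is an AND over the labels of an
  OR over the positions of an AND over the bits of all cells; with about \<open>n * K\<close> variables (up to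
  logarithms) it has \<open>O(n\<^sup>2)\<close> gates and size at most \<open>n * N\<close>, so the best \<open>n\<close> allowed by \<open>N\<close>, \<open>S\<close>, \<open>G\<close>
  gives the bound. When no such \<open>n \<ge> 1\<close> exists, a single AND gate suffices.\<close>

subsection \<open>Adversary bound\<close>

definition inner_prod :: "nat \<Rightarrow> (nat \<Rightarrow> complex) \<Rightarrow> (nat \<Rightarrow> complex) \<Rightarrow> complex" where
  "inner_prod D a b = (\<Sum>k<D. cnj (a k) * b k)"

lemma inner_prod_apply_mat:
  assumes "unitary D U"
  shows "inner_prod D (apply_mat D U a) (apply_mat D U b) = inner_prod D a b"
proof -
  have "inner_prod D (apply_mat D U a) (apply_mat D U b)
      = (\<Sum>l<D. \<Sum>j<D. \<Sum>k<D. cnj (a j) * b k * (cnj (U l j) * U l k))"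
    unfolding inner_prod_def apply_mat_def cnj_sum sum_product
    by (intro sum.cong refl) (simp add: mult_ac)
  also have "\<dots> = (\<Sum>j<D. \<Sum>l<D. \<Sum>k<D. cnj (a j) * b k * (cnj (U l j) * U l k))"
    by (rule sum.swap)
  also have "\<dots> = (\<Sum>j<D. \<Sum>k<D. \<Sum>l<D. cnj (a j) * b k * (cnj (U l j) * U l k))"
    by (rule sum.cong[OF refl], rule sum.swap)
  also have "\<dots> = (\<Sum>j<D. \<Sum>k<D. cnj (a j) * b k * (if j = k then 1 else 0))"
    using assms by (simp add: unitary_def flip: sum_distrib_left)
  also have "\<dots> = inner_prod D a b"
    by (simp add: inner_prod_def if_distrib cong: if_cong)
  finally show ?thesis .
qed

lemma inner_prod_self: "inner_prod D a a = of_real (\<Sum>k<D. (cmod (a k))\<^sup>2)"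
  by (simp add: inner_prod_def complex_norm_square mult.commute del: of_real_power)

section \<open>The oracle on the blocks of basis states with a common query index\<close>

lemma flip_index_mod: "N > 0 \<Longrightarrow> flip_index N x k mod N = k mod N"
proof -
  assume "N > 0"
  have "(k - N) mod N = k mod N" if "(k div N) mod 2 \<noteq> 0"
  proof -
    have "N \<le> k" using that by (cases "k < N") auto
    then show ?thesis by (simp add: le_mod_geq)
  qed
  then show ?thesis by (simp add: flip_index_def)
qed

lemma flip_index_less:
  assumes "N > 0" "k < 2 * N * m" shows "flip_index N x k < 2 * N * m"
proof -
  have "k + N < 2 * N * m" if e: "(k div N) mod 2 = 0"
  proof -
    have "k div N < 2 * m" using assms by (simp add: less_mult_imp_div_less mult_ac)
    \<comment> \<open>The dimension consists of \<open>2 * m\<close> blocks of length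
      \<open>N\<close>. This number is even, so a block with an even number is never the last one,
      and adding \<open>N\<close> stays in range.\<close>
    then have "k div N \<noteq> 2 * m - 1" using e by (cases m) auto
    with \<open>k div N < 2 * m\<close> have "Suc (k div N) < 2 * m" by linarith
    then have "(k + N) div N < 2 * m" using assms by simp
    then show ?thesis using assms
      by (metis div_less_iff_less_mult mult.commute mult.assoc)
  qed
  then show ?thesis using assms by (auto simp: flip_index_def)
qed

lemma flip_index_flip_index:
  assumes "N > 0" shows "flip_index N x (flip_index N x k) = k"
proof (cases "x (k mod N)")
  case True
  show ?thesis
  proof (cases "even (k div N)")
    case e: True
    with True assms show ?thesis by (simp add: flip_index_def even_iff_mod_2_eq_zero[symmetric])
  next
    case o: False
    then have "N \<le> k" by (cases "k < N") auto
    then have "k div N = Suc ((k - N) div N)" "k mod N = (k - N) mod N"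
      using assms by (simp_all add: le_div_geq le_mod_geq)
    with o True \<open>N \<le> k\<close> show ?thesis by (simp add: flip_index_def even_iff_mod_2_eq_zero[symmetric])
  qed
qed (simp add: flip_index_def)

definition index_block :: "nat \<Rightarrow> nat \<Rightarrow> nat \<Rightarrow> nat set" where
  "index_block N D q = {k. k < D \<and> k mod N = q}"

lemma finite_index_block [simp]: "finite (index_block N D q)"
  by (simp add: index_block_def)

lemma sum_index_block:
  fixes g :: "nat \<Rightarrow> 'a :: comm_monoid_add"
  assumes "N > 0"
  shows "(\<Sum>q<N. \<Sum>k\<in>index_block N D q. g k) = (\<Sum>k<D. g k)"
proof -
  have "(\<Sum>q<N. \<Sum>k\<in>index_block N D q. g k)
      = (\<Sum>q\<in>{..<N}. sum g {k \<in> {..<D}. k mod N = q})"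
    by (simp add: index_block_def)
  also have "\<dots> = (\<Sum>k<D. g k)"
    by (rule sum.group) (use assms in auto)
  finally show ?thesis .
qed

lemma sum_index_block_flip:
  assumes "N > 0" "D = 2 * N * m"
  shows "(\<Sum>k\<in>index_block N D q. g (flip_index N x k)) = (\<Sum>k\<in>index_block N D q. g k)"
  by (rule sum.reindex_bij_witness[of _ "flip_index N x" "flip_index N x"])
     (use assms flip_index_flip_index flip_index_less flip_index_mod in
       \<open>auto simp: index_block_def\<close>)

text \<open>The query weight of the adversary method: for a unit state, the probability that a
  measurement finds variable \<open>q\<close> in the query register.\<close>

definition block_weight :: "nat \<Rightarrow> nat \<Rightarrow> nat \<Rightarrow> (nat \<Rightarrow> complex) \<Rightarrow> real" where
  "block_weight N D q a = (\<Sum>k\<in>index_block N D q. (cmod (a k))\<^sup>2)"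

lemma block_weight_nonneg [simp]: "0 \<le> block_weight N D q a"
  by (simp add: block_weight_def sum_nonneg)

lemma block_weight_query_op:
  "N > 0 \<Longrightarrow> D = 2 * N * m \<Longrightarrow> block_weight N D q (query_op N x a) = block_weight N D q a"
  using sum_index_block_flip[of N D m "\<lambda>k. (cmod (a k))\<^sup>2"]
  by (simp add: block_weight_def query_op_def)

lemma sum_block_weight:
  "N > 0 \<Longrightarrow> (\<Sum>q<N. block_weight N D q a) = (\<Sum>k<D. (cmod (a k))\<^sup>2)"
  unfolding block_weight_def by (rule sum_index_block)

lemma norm_query_op:
  "N > 0 \<Longrightarrow> D = 2 * N * m \<Longrightarrow>
    (\<Sum>k<D. (cmod (query_op N x a k))\<^sup>2) = (\<Sum>k<D. (cmod (a k))\<^sup>2)"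
  by (simp add: block_weight_query_op flip: sum_block_weight)

lemma norm_apply_mat:
  assumes "unitary D U"
  shows "(\<Sum>k<D. (cmod (apply_mat D U a k))\<^sup>2) = (\<Sum>k<D. (cmod (a k))\<^sup>2)"
  using inner_prod_apply_mat[OF assms, of a a] unfolding inner_prod_self of_real_eq_iff .

section \<open>Decay of inner products under queries\<close>

lemma mult_le_weighted_squares:
  fixes a b u w :: real
  assumes "u > 0" "w > 0" "u * w \<ge> 1"
  shows "2 * (a * b) \<le> u * a\<^sup>2 + w * b\<^sup>2"
proof -
  have "0 \<le> (u * a - b)\<^sup>2" by simp
  then have "2 * (a * b) * u \<le> u * a\<^sup>2 * u + b\<^sup>2"
    by (simp add: power2_eq_square algebra_simps)
  also have "b\<^sup>2 \<le> u * w * b\<^sup>2"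
    using mult_right_mono[OF assms(3), of "b\<^sup>2"] by simp
  finally have "2 * (a * b) * u \<le> (u * a\<^sup>2 + w * b\<^sup>2) * u"
    by (simp add: algebra_simps)
  then show ?thesis using assms(1) by simp
qed

lemma norm_block_inner_le:
  fixes u w :: real
  assumes "u > 0" "w > 0" "u * w \<ge> 1"
  shows "2 * cmod (\<Sum>k\<in>index_block N D q. cnj (a k) * b k)
      \<le> u * block_weight N D q a + w * block_weight N D q b"
proof -
  have "2 * cmod (\<Sum>k\<in>index_block N D q. cnj (a k) * b k)
      \<le> 2 * (\<Sum>k\<in>index_block N D q. cmod (a k) * cmod (b k))"
    using norm_sum[of "\<lambda>k. cnj (a k) * b k" "index_block N D q"]
    by (simp add: norm_mult)
  also have "\<dots> \<le> (\<Sum>k\<in>index_block N D q. u * (cmod (a k))\<^sup>2 + w * (cmod (b k))\<^sup>2)"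
    unfolding sum_distrib_left by (intro sum_mono mult_le_weighted_squares assms)
  also have "\<dots> = u * block_weight N D q a + w * block_weight N D q b"
    by (simp add: block_weight_def sum.distrib sum_distrib_left)
  finally show ?thesis .
qed

text \<open>On a block where the inputs agree, both oracles act by the same permutation and leave
  the inner product alone. On the other blocks the weighted AM-GM bound is used once before and once
  after the query; the query does not change block weights, so each use costs half of the stated
  sum.\<close>

lemma inner_prod_query_op_diff:
  fixes u w :: "nat \<Rightarrow> real"
  assumes N: "N > 0" and D: "D = 2 * N * m"
    and uw: "\<And>q. q < N \<Longrightarrow> x q \<noteq> y q \<Longrightarrow> u q > 0 \<and> w q > 0 \<and> u q * w q \<ge> 1"
  shows "cmod (inner_prod D a b) \<le> cmod (inner_prod D (query_op N x a) (query_op N y b))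
    + (\<Sum>q | q < N \<and> x q \<noteq> y q. u q * block_weight N D q a + w q * block_weight N D q b)"
proof -
  define s where "s q a b = (\<Sum>k\<in>index_block N D q. cnj (a k) * b k)" for q and a b :: "nat \<Rightarrow> complex"
  let ?a = "query_op N x a" and ?b = "query_op N y b"
  let ?Z = "{q. q < N \<and> x q \<noteq> y q}"
  have ip: "inner_prod D a b = (\<Sum>q<N. s q a b)" for a b
    unfolding inner_prod_def s_def by (rule sum_index_block[OF N, symmetric])
  have eq: "s q ?a ?b = s q a b" if "x q = y q" for q
  proof -
    have "flip_index N y k = flip_index N x k" if "k \<in> index_block N D q" for k
      using that \<open>x q = y q\<close> by (auto simp: flip_index_def index_block_def)
    then have "s q ?a ?b = (\<Sum>k\<in>index_block N D q. cnj (a (flip_index N x k)) * b (flip_index N x k))"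
      unfolding s_def query_op_def by (intro sum.cong) simp_all
    also have "\<dots> = s q a b"
      unfolding s_def by (rule sum_index_block_flip[OF N D])
    finally show ?thesis .
  qed
  have "inner_prod D a b - inner_prod D ?a ?b = (\<Sum>q<N. s q a b - s q ?a ?b)"
    by (simp add: ip sum_subtractf)
  also have "(\<Sum>q<N. s q a b - s q ?a ?b) = (\<Sum>q\<in>?Z. s q a b - s q ?a ?b)"
    by (rule sum.mono_neutral_right) (simp_all add: eq subset_eq)
  finally have diff: "inner_prod D a b - inner_prod D ?a ?b = (\<Sum>q\<in>?Z. s q a b - s q ?a ?b)" .
  have "cmod (inner_prod D a b - inner_prod D ?a ?b)
      \<le> (\<Sum>q\<in>?Z. u q * block_weight N D q a + w q * block_weight N D q b)"
    unfolding diff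
  proof (rule sum_norm_le)
    fix q assume "q \<in> ?Z"
    then have "q < N" "x q \<noteq> y q" by blast+
    from uw[OF this] have uwq: "u q > 0" "w q > 0" "u q * w q \<ge> 1" by blast+
    show "cmod (s q a b - s q ?a ?b) \<le> u q * block_weight N D q a + w q * block_weight N D q b"
      using norm_block_inner_le[OF uwq, where N = N and D = D and q = q and a = a and b = b] norm_block_inner_le[OF uwq, where N = N and D = D and q = q and a = ?a and b = ?b]
        norm_triangle_ineq4[of "s q a b" "s q ?a ?b"]
      unfolding block_weight_query_op[OF N D] s_def[symmetric] by argo
  qed
  then show ?thesis
    using norm_triangle_ineq2[of "inner_prod D a b" "inner_prod D ?a ?b"] by linarith
qed

lemma run_norm:
  assumes "N > 0" "D = 2 * N * m" "Us \<noteq> []" "\<forall>U\<in>set Us. unitary D U"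
  shows "(\<Sum>k<D. (cmod (run N D x Us v k))\<^sup>2) = (\<Sum>k<D. (cmod (v k))\<^sup>2)"
  using assms
  by (induction N D x Us v rule: run.induct) (simp_all add: norm_apply_mat norm_query_op)

text \<open>The progress measure is the sum of the inner products over all related pairs. Unitaries
  preserve it and each of the \<open>T\<close> queries lowers it by at most \<open>\<Delta>\<close>.
  The starting states are arbitrary families because the induction continues from states that
  already depend on the input; they are indexed by inputs, so that pairs sharing an input share its
  state.\<close>

lemma run_inner_prod_sum:
  fixes u w :: "'r \<Rightarrow> nat \<Rightarrow> real" and inx iny :: "'r \<Rightarrow> nat \<Rightarrow> bool"
  assumes N: "N > 0" and D: "D = 2 * N * m"
    and uw: "\<And>r q. r \<in> R \<Longrightarrow> q < N \<Longrightarrow> inx r q \<noteq> iny r q \<Longrightarrow>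
        u r q > 0 \<and> w r q > 0 \<and> u r q * w r q \<ge> 1"
    and cost: "\<And>a b. (\<And>z. (\<Sum>k<D. (cmod (a z k))\<^sup>2) = 1) \<Longrightarrow> (\<And>z. (\<Sum>k<D. (cmod (b z k))\<^sup>2) = 1) \<Longrightarrow>
        (\<Sum>r\<in>R. \<Sum>q | q < N \<and> inx r q \<noteq> iny r q.
          u r q * block_weight N D q (a (inx r)) + w r q * block_weight N D q (b (iny r))) \<le> \<Delta>"
    and Us: "length Us = Suc T" "\<forall>U\<in>set Us. unitary D U"
    and a: "\<And>z. (\<Sum>k<D. (cmod (a z k))\<^sup>2) = 1" and b: "\<And>z. (\<Sum>k<D. (cmod (b z k))\<^sup>2) = 1"
  shows "(\<Sum>r\<in>R. cmod (inner_prod D (a (inx r)) (b (iny r))))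
    \<le> (\<Sum>r\<in>R. cmod (inner_prod D (run N D (inx r) Us (a (inx r))) (run N D (iny r) Us (b (iny r)))))
      + T * \<Delta>"
  using Us a b
proof (induction T arbitrary: Us a b)
  case 0
  then obtain U where "Us = [U]" by (cases Us) auto
  with 0 show ?case by (simp add: inner_prod_apply_mat)
next
  case (Suc T)
  then obtain U V Vs where Us: "Us = U # V # Vs" by (metis length_Suc_conv)
  then have U: "unitary D U" using Suc.prems by simp
  define a' where "a' z = apply_mat D U (a z)" for z
  define b' where "b' z = apply_mat D U (b z)" for z
  have n': "(\<Sum>k<D. (cmod (a' z k))\<^sup>2) = 1" "(\<Sum>k<D. (cmod (b' z k))\<^sup>2) = 1" for z
    using Suc.prems by (simp_all add: a'_def b'_def norm_apply_mat[OF U])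
  have "(\<Sum>r\<in>R. cmod (inner_prod D (a (inx r)) (b (iny r))))
      = (\<Sum>r\<in>R. cmod (inner_prod D (a' (inx r)) (b' (iny r))))"
    by (simp add: a'_def b'_def inner_prod_apply_mat[OF U])
  also have "\<dots> \<le> (\<Sum>r\<in>R. cmod (inner_prod D (query_op N (inx r) (a' (inx r))) (query_op N (iny r) (b' (iny r))))
      + (\<Sum>q | q < N \<and> inx r q \<noteq> iny r q.
          u r q * block_weight N D q (a' (inx r)) + w r q * block_weight N D q (b' (iny r))))"
    by (intro sum_mono inner_prod_query_op_diff[OF N D] uw)
  also have "\<dots> \<le> (\<Sum>r\<in>R. cmod (inner_prod D (query_op N (inx r) (a' (inx r))) (query_op N (iny r) (b' (iny r))))) + \<Delta>"
    using cost[of a' b', OF n'(1) n'(2)] by (simp only: sum.distrib add_left_mono)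
  also have "(\<Sum>r\<in>R. cmod (inner_prod D (query_op N (inx r) (a' (inx r))) (query_op N (iny r) (b' (iny r)))))
    \<le> (\<Sum>r\<in>R. cmod (inner_prod D (run N D (inx r) (V # Vs) (query_op N (inx r) (a' (inx r))))
          (run N D (iny r) (V # Vs) (query_op N (iny r) (b' (iny r)))))) + T * \<Delta>"
  proof (rule Suc.IH[of "V # Vs" "\<lambda>z. query_op N z (a' z)" "\<lambda>z. query_op N z (b' z)"])
    show "length (V # Vs) = Suc T" "\<forall>U\<in>set (V # Vs). unitary D U"
      using Suc.prems(1,2) Us by simp_all
  qed (simp_all only: norm_query_op[OF N D] n')
  finally show ?case by (simp add: Us a'_def b'_def algebra_simps)
qed

lemma norm_inner_prod_le:
  assumes "A \<subseteq> {..<D}" and a: "(\<Sum>k<D. (cmod (a k))\<^sup>2) = 1" and b: "(\<Sum>k<D. (cmod (b k))\<^sup>2) = 1"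
    and pa: "(\<Sum>k\<in>A. (cmod (a k))\<^sup>2) \<ge> 2/3" and pb: "(\<Sum>k\<in>A. (cmod (b k))\<^sup>2) \<le> 1/3"
  shows "cmod (inner_prod D a b) \<le> 17/18"
proof -
  let ?B = "{..<D} - A"
  let ?g = "\<lambda>k. cmod (a k) * cmod (b k)"
  let ?p = "\<lambda>k. (cmod (a k))\<^sup>2" and ?q = "\<lambda>k. (cmod (b k))\<^sup>2"
  have split: "(\<Sum>k<D. h k) = (\<Sum>k\<in>?B. h k) + (\<Sum>k\<in>A. h k)" for h :: "nat \<Rightarrow> real"
    by (rule sum.subset_diff) (use assms in auto)
  have "2 * (\<Sum>k\<in>A. ?g k) \<le> (\<Sum>k\<in>A. (2/3) * ?p k + (3/2) * ?q k)"
    unfolding sum_distrib_left by (intro sum_mono mult_le_weighted_squares) auto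
  \<comment> \<open>The weights 2/3 and 3/2 have product 1, and the smaller one goes with the larger
    mass: that of \<open>a\<close> on \<open>A\<close>, that of \<open>b\<close> off
    \<open>A\<close>. Writing \<open>p\<close> and \<open>q\<close> for the masses of
    \<open>a\<close> and \<open>b\<close> on \<open>A\<close>, the two bounds add up to
    \<open>13/6 - 5/6 * (p - q)\<close>, which is at most 34/18.\<close>
  moreover have "2 * (\<Sum>k\<in>?B. ?g k) \<le> (\<Sum>k\<in>?B. (3/2) * ?p k + (2/3) * ?q k)"
    unfolding sum_distrib_left by (intro sum_mono mult_le_weighted_squares) auto
  moreover have "cmod (inner_prod D a b) \<le> (\<Sum>k<D. ?g k)"
    using norm_sum[of "\<lambda>k. cnj (a k) * b k" "{..<D}"] by (simp add: norm_mult inner_prod_def)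
  ultimately show ?thesis
    using a b pa pb unfolding split[of ?g] split[of ?p] split[of ?q] sum.distrib sum_distrib_left[symmetric]
    by linarith
qed

section \<open>Double counting of related pairs\<close>

lemma sum_card_fibre_le:
  fixes px :: "'r \<Rightarrow> 'a"
  assumes "finite R" "\<And>r. r \<in> R \<Longrightarrow> k \<le> card {r'\<in>R. px r' = px r}"
  shows "card (px ` R) * k \<le> card R"
proof -
  have "card (px ` R) * k = (\<Sum>x\<in>px ` R. k)" by simp
  also have "\<dots> \<le> (\<Sum>x\<in>px ` R. card {r'\<in>R. px r' = x})"
    using assms(2) by (intro sum_mono) auto
  also have "\<dots> = (\<Sum>x\<in>px ` R. \<Sum>r\<in>{r'\<in>R. px r' = x}. 1)" by simp
  also have "\<dots> = card R"
    using sum.group[of R "px ` R" px "\<lambda>_. 1 :: nat"] assms(1) by simp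
  finally show ?thesis .
qed

text \<open>Grouped by the value \<open>x\<close> of \<open>px\<close>, the pairs that differ at
  \<open>q\<close> are as many as the denominator says, so the division cancels their number. What
  remains for each \<open>x\<close> is at most \<open>C\<close> times the total weight over all
  \<open>q\<close>, which is 1.\<close>

lemma sum_block_weight_div_card_le:
  fixes px :: "'r \<Rightarrow> 'a" and a :: "'a \<Rightarrow> nat \<Rightarrow> complex" and C :: real
  assumes "finite R" "N > 0" "C \<ge> 0" and a: "\<And>x. (\<Sum>k<D. (cmod (a x k))\<^sup>2) = 1"
  shows "(\<Sum>r\<in>R. \<Sum>q | q < N \<and> P r q.
        C / card {r'\<in>R. px r' = px r \<and> P r' q} * block_weight N D q (a (px r))) \<le> C * card (px ` R)"
proof -
  define l where "l x q = card {r'\<in>R. px r' = x \<and> P r' q}" for x q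
  let ?g = "\<lambda>r q. if P r q then C / l (px r) q * block_weight N D q (a (px r)) else 0"
  have "(\<Sum>r\<in>R. \<Sum>q | q < N \<and> P r q. C / l (px r) q * block_weight N D q (a (px r)))
      = (\<Sum>r\<in>R. \<Sum>q<N. ?g r q)"
    by (simp add: sum.inter_filter lessThan_def flip: sum.inter_filter)
  also have "\<dots> = (\<Sum>x\<in>px ` R. \<Sum>r\<in>{r\<in>R. px r = x}. \<Sum>q<N. ?g r q)"
    using assms(1) by (intro sum.group[symmetric]) auto
  also have "\<dots> = (\<Sum>x\<in>px ` R. \<Sum>q<N. \<Sum>r\<in>{r\<in>R. px r = x}. ?g r q)"
    by (rule sum.cong[OF refl], rule sum.swap)
  also have "\<dots> \<le> (\<Sum>x\<in>px ` R. \<Sum>q<N. C * block_weight N D q (a x))"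
  proof (intro sum_mono)
    fix x q
    have "(\<Sum>r\<in>{r\<in>R. px r = x}. ?g r q)
        = (\<Sum>r\<in>{r\<in>R. px r = x}. if P r q then C / l x q * block_weight N D q (a x) else 0)"
      by (rule sum.cong) auto
    also have "\<dots> = (\<Sum>r\<in>{r\<in>{r\<in>R. px r = x}. P r q}. C / l x q * block_weight N D q (a x))"
      using assms(1) by (simp only: sum.inter_filter finite_Collect_conjI disjI1 Collect_mem_eq)
    also have "{r\<in>{r\<in>R. px r = x}. P r q} = {r\<in>R. px r = x \<and> P r q}" by auto
    \<comment> \<open>If the denominator is 0, the sum is over the empty set.\<close>
    also have "(\<Sum>r\<in>{r\<in>R. px r = x \<and> P r q}. C / l x q * block_weight N D q (a x))
        \<le> C * block_weight N D q (a x)"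
      using \<open>C \<ge> 0\<close> by (cases "l x q = 0") (simp_all add: l_def)
    finally show "(\<Sum>r\<in>{r\<in>R. px r = x}. ?g r q) \<le> C * block_weight N D q (a x)" .
  qed
  also have "\<dots> = C * card (px ` R)"
    by (simp add: sum_block_weight[OF \<open>N > 0\<close>] a flip: sum_distrib_left)
  finally show ?thesis unfolding l_def .
qed

text \<open>Ambainis' bound for a relation given as an indexed family, so that distinct indices may
  denote the same input.\<close>

theorem adversary_bound:
  fixes R :: "'r set" and px :: "'r \<Rightarrow> 'a" and py :: "'r \<Rightarrow> 'b"
    and ix :: "'a \<Rightarrow> nat \<Rightarrow> bool" and iy :: "'b \<Rightarrow> nat \<Rightarrow> bool"
  defines "differ \<equiv> \<lambda>r q. ix (px r) q \<noteq> iy (py r) q"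
  assumes alg: "bounded_error_alg N f T" and N: "N > 0"
    and R: "finite R" "R \<noteq> {}"
    and f: "\<And>r. r \<in> R \<Longrightarrow> f (ix (px r))" "\<And>r. r \<in> R \<Longrightarrow> \<not> f (iy (py r))"
    and m: "m > 0" "\<And>r. r \<in> R \<Longrightarrow> m \<le> card {r'\<in>R. px r' = px r}"
    and m': "m' > 0" "\<And>r. r \<in> R \<Longrightarrow> m' \<le> card {r'\<in>R. py r' = py r}"
    and L: "L > 0" "\<And>r q. r \<in> R \<Longrightarrow> q < N \<Longrightarrow> differ r q \<Longrightarrow>
        card {r'\<in>R. px r' = px r \<and> differ r' q} * card {r'\<in>R. py r' = py r \<and> differ r' q} \<le> L"
  shows "sqrt (real m * real m' / real L) \<le> 36 * real T"
proof -
  from alg obtain M Us A where Us: "length Us = Suc T" "\<forall>U\<in>set Us. unitary (2*N*M) U"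
    and "M > 0" and A: "A \<subseteq> {..<2*N*M}"
    and acc: "\<And>x. f x \<Longrightarrow> accept_prob N M Us A x \<ge> 2/3"
      "\<And>x. \<not> f x \<Longrightarrow> accept_prob N M Us A x \<le> 1/3"
    unfolding bounded_error_alg_def by metis
  define D where "D = 2*N*M"
  have "D > 0" using N \<open>M > 0\<close> by (simp add: D_def)
  define lx where "lx r q = card {r'\<in>R. px r' = px r \<and> differ r' q}" for r q
  define ly where "ly r q = card {r'\<in>R. py r' = py r \<and> differ r' q}" for r q
  \<comment> \<open>This choice balances the two terms of \<open>\<Delta>\<close>: with at most
    \<open>card R / m\<close> and \<open>card R / m'\<close> inputs on the two sides, both terms are
    bounded by \<open>card R * sqrt L / sqrt (m * m')\<close>.\<close>
  define s where "s = sqrt (m / m')"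
  have s: "s > 0" using m m' by (simp add: s_def)
  define u where "u r q = s * sqrt L / lx r q" for r q
  define w where "w r q = sqrt L / s / ly r q" for r q
  define \<Delta> where "\<Delta> = s * sqrt L * card (px ` R) + sqrt L / s * card (py ` R)"
  have uw: "u r q > 0 \<and> w r q > 0 \<and> u r q * w r q \<ge> 1" if "r \<in> R" "q < N" "differ r q" for r q
  proof -
    have "lx r q > 0" "ly r q > 0" using that R by (auto simp: lx_def ly_def card_gt_0_iff)
    moreover have "real (lx r q) * real (ly r q) \<le> L"
      unfolding of_nat_mult[symmetric] of_nat_le_iff lx_def ly_def by (rule L(2)[OF that])
    ultimately show ?thesis using s L(1) by (simp add: u_def w_def field_simps)
  qed
  have cost: "(\<Sum>r\<in>R. \<Sum>q | q < N \<and> differ r q.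
      u r q * block_weight N D q (a (ix (px r))) + w r q * block_weight N D q (b (iy (py r)))) \<le> \<Delta>"
    if "\<And>z. (\<Sum>k<D. (cmod (a z k))\<^sup>2) = 1" "\<And>z. (\<Sum>k<D. (cmod (b z k))\<^sup>2) = 1" for a b
    using sum_block_weight_div_card_le[OF R(1) N, where C = "s * sqrt L" and D = D and a = "\<lambda>x. a (ix x)" and P = differ and px = px]
      sum_block_weight_div_card_le[OF R(1) N, where C = "sqrt L / s" and D = D and a = "\<lambda>x. b (iy x)" and P = differ and px = py] that s L(1)
    unfolding u_def w_def lx_def ly_def \<Delta>_def sum.distrib by simp
  let ?\<psi> = "\<lambda>z. run N D z Us init_state"
  have init: "(\<Sum>k<D. (cmod (init_state k))\<^sup>2) = 1" "inner_prod D init_state init_state = 1"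
    using \<open>D > 0\<close> by (simp_all add: init_state_def inner_prod_def if_distribR if_distrib[of cmod]
        if_distrib[of "\<lambda>z. z\<^sup>2"] if_distrib[of cnj] if_distrib[of "\<lambda>z. z * _"] cong: if_cong)
  have "Us \<noteq> []" using Us(1) by auto
  from run_norm[OF N D_def this, folded D_def] have norm: "(\<Sum>k<D. (cmod (?\<psi> z k))\<^sup>2) = 1" for z
    using Us(2) init(1) by (simp add: D_def)
  have "real (card R) = (\<Sum>r\<in>R. cmod (inner_prod D init_state init_state))"
    by (simp add: init)
  also have "\<dots> \<le> (\<Sum>r\<in>R. cmod (inner_prod D (?\<psi> (ix (px r))) (?\<psi> (iy (py r))))) + T * \<Delta>"
    by (rule run_inner_prod_sum[where u = u and w = w and a = "\<lambda>_. init_state" and b = "\<lambda>_. init_state", OF N D_def])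
      (use uw cost Us init in \<open>simp_all add: differ_def D_def\<close>)
  also have "(\<Sum>r\<in>R. cmod (inner_prod D (?\<psi> (ix (px r))) (?\<psi> (iy (py r))))) \<le> (\<Sum>r\<in>R. 17/18)"
    using A acc f norm unfolding accept_prob_def D_def[symmetric]
    by (intro sum_mono norm_inner_prod_le) auto
  \<comment> \<open>Every pair starts with inner product 1 and ends with at most 17/18, so the total
    drops by at least \<open>card R / 18\<close>. The two equal terms of \<open>\<Delta>\<close>
    later turn 18 into 36.\<close>
  finally have R_le: "real (card R) \<le> 18 * (T * \<Delta>)" by simp
  have "real (card (px ` R)) \<le> card R / m" "real (card (py ` R)) \<le> card R / m'"
    using sum_card_fibre_le[OF R(1) m(2)] sum_card_fibre_le[OF R(1) m'(2)] m(1) m'(1)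
    by (simp_all add: field_simps flip: of_nat_mult)
  then have "\<Delta> \<le> s * sqrt L * (card R / m) + sqrt L / s * (card R / m')"
    unfolding \<Delta>_def using s L(1) by (intro add_mono mult_left_mono) simp_all
  also have "\<dots> = card R * (sqrt L * (s / m + 1 / (s * m')))"
    by (simp add: algebra_simps)
  also have "s / m + 1 / (s * m') = 2 / (sqrt m * sqrt m')"
    using m(1) m'(1) real_sqrt_pow2[of m] real_sqrt_pow2[of m']
    by (simp add: s_def real_sqrt_divide field_simps power2_eq_square)
  finally have "18 * (T * \<Delta>) \<le> 18 * (T * (card R * (sqrt L * (2 / (sqrt m * sqrt m')))))"
    by (intro mult_left_mono) simp_all
  with R_le have "real (card R) * 1 \<le> real (card R) * (36 * T * sqrt L / (sqrt m * sqrt m'))"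
    by (simp add: mult_ac)
  moreover have "card R > 0" using R by (simp add: card_gt_0_iff)
  ultimately have "1 \<le> 36 * T * sqrt L / (sqrt m * sqrt m')"
    by (subst (asm) mult_le_cancel_left_pos) simp_all
  then show ?thesis using m(1) m'(1) L(1) by (simp add: real_sqrt_divide real_sqrt_mult field_simps)
qed

subsection \<open>Every function of finitely many bits has an algorithm\<close>

definition basis_state :: "nat \<Rightarrow> nat \<Rightarrow> complex" where
  "basis_state k = (\<lambda>j. if j = k then 1 else 0)"

definition perm_mat :: "(nat \<Rightarrow> nat) \<Rightarrow> nat \<Rightarrow> nat \<Rightarrow> complex" where
  "perm_mat \<pi> j k = (if j = \<pi> k then 1 else 0)"

lemma unitary_perm_mat:
  assumes "bij_betw \<pi> {..<D} {..<D}"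
  shows "unitary D (perm_mat \<pi>)"
  unfolding unitary_def
proof (intro allI impI)
  fix j k assume jk: "j < D" "k < D"
  have "(\<Sum>l<D. cnj (perm_mat \<pi> l j) * perm_mat \<pi> l k)
      = (\<Sum>l<D. if l = \<pi> j then (if \<pi> j = \<pi> k then 1 else 0) else 0)"
    by (rule sum.cong) (auto simp: perm_mat_def)
  also have "\<dots> = (if \<pi> j = \<pi> k then 1 else 0)"
    using bij_betwE[OF assms] jk by simp
  also have "\<dots> = (if j = k then 1 else 0)"
    using bij_betw_imp_inj_on[OF assms] jk by (auto dest: inj_onD)
  finally show "(\<Sum>l<D. cnj (perm_mat \<pi> l j) * perm_mat \<pi> l k) = (if j = k then 1 else 0)" .
qed

lemma apply_perm_mat_basis_state:
  assumes "k < D" shows "apply_mat D (perm_mat \<pi>) (basis_state k) = basis_state (\<pi> k)"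
proof
  fix j
  have "apply_mat D (perm_mat \<pi>) (basis_state k) j
      = (\<Sum>i<D. if i = k then (if j = \<pi> k then 1 else 0) else 0)"
    unfolding apply_mat_def by (rule sum.cong) (auto simp: perm_mat_def basis_state_def)
  then show "apply_mat D (perm_mat \<pi>) (basis_state k) j = basis_state (\<pi> k) j"
    using assms by (simp add: basis_state_def)
qed

lemma query_op_basis_state:
  assumes "N > 0" shows "query_op N x (basis_state k) = basis_state (flip_index N x k)"
proof -
  have "flip_index N x j = k \<longleftrightarrow> j = flip_index N x k" for j
    using flip_index_flip_index[OF assms, of x] by metis
  then show ?thesis by (simp add: query_op_def basis_state_def)
qed

text \<open>A step of the classical algorithm is prescribed only on the states it can reach, whereas
  a unitary needs a permutation of the whole basis. The two complements have equal size, so any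
  bijection between them fills the gap.\<close>

lemma ex_bij_betw_extending:
  fixes g :: "nat \<Rightarrow> nat"
  assumes "inj_on g A" "A \<subseteq> {..<D}" "g ` A \<subseteq> {..<D}"
  shows "\<exists>\<pi>. bij_betw \<pi> {..<D} {..<D} \<and> (\<forall>k\<in>A. \<pi> k = g k)"
proof -
  have fin: "finite A" using assms(2) finite_subset by blast
  have "card ({..<D} - A) = card ({..<D} - g ` A)"
    using assms fin by (simp add: card_Diff_subset card_image)
  then obtain h where h: "bij_betw h ({..<D} - A) ({..<D} - g ` A)"
    using finite_same_card_bij by blast
  let ?\<pi> = "\<lambda>k. if k \<in> A then g k else h k"
  have "bij_betw ?\<pi> A (g ` A)"
    using assms(1) by (simp add: bij_betw_def inj_on_def image_def)
  moreover have "bij_betw ?\<pi> ({..<D} - A) ({..<D} - g ` A)"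
    using h by (rule bij_betw_cong[THEN iffD1, rotated]) auto
  ultimately have "bij_betw ?\<pi> (A \<union> ({..<D} - A)) (g ` A \<union> ({..<D} - g ` A))"
    by (rule bij_betw_combine) auto
  then have "bij_betw ?\<pi> {..<D} {..<D}"
    using assms(2,3) by (simp add: Un_absorb1)
  then show ?thesis by (intro exI[of _ ?\<pi>]) simp
qed

section \<open>Reading the input bit by bit\<close>

fun read_bits :: "(nat \<Rightarrow> bool) \<Rightarrow> nat \<Rightarrow> nat" where
  "read_bits x 0 = 0"
| "read_bits x (Suc t) = 2 * read_bits x t + of_bool (x t)"

lemma read_bits_less: "read_bits x t < 2 ^ t"
  by (induction t) (auto simp: of_bool_def)

lemma read_bits_inject: "read_bits x t = read_bits y t \<Longrightarrow> i < t \<Longrightarrow> x i = y i"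
proof (induction t)
  case (Suc t)
  then have eq: "2 * read_bits x t + of_bool (x t) = 2 * read_bits y t + of_bool (y t)" by simp
  have "x t = y t" using arg_cong[OF eq, of even] by (cases "x t"; cases "y t") simp_all
  with eq Suc show ?case by (auto simp: less_Suc_eq)
qed simp

text \<open>The classical algorithm queries the bits in order; after each query the answer bit is shifted
  into the workspace register.\<close>

definition read_index :: "nat \<Rightarrow> (nat \<Rightarrow> bool) \<Rightarrow> nat \<Rightarrow> nat" where
  "read_index N x t = t mod N + 2 * N * read_bits x t"

lemma read_index_less:
  assumes "N > 0" "t \<le> N" shows "read_index N x t < 2 * N * 2 ^ N"
proof -
  have "read_bits x t < 2 ^ N"
    using read_bits_less[of x t] assms(2) by (meson less_le_trans one_le_numeral power_increasing)
  then have "2 * N * Suc (read_bits x t) \<le> 2 * N * 2 ^ N" by (intro mult_le_mono) auto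
  moreover have "t mod N < N" using assms by simp
  ultimately show ?thesis unfolding read_index_def mult_Suc_right by linarith
qed

lemma flip_read_index:
  assumes "t < N"
  shows "flip_index N x (read_index N x t) = t + N * read_bits x (Suc t)"
proof -
  have "read_index N x t = t + N * (2 * read_bits x t)" using assms by (simp add: read_index_def)
  moreover from this have "read_index N x t mod N = t" "read_index N x t div N = 2 * read_bits x t"
    using assms by simp_all
  ultimately show ?thesis by (simp add: flip_index_def)
qed

lemma ex_shift_bij:
  assumes "t < N"
  shows "\<exists>\<pi>. bij_betw \<pi> {..<2 * N * 2 ^ N} {..<2 * N * 2 ^ N} \<and>
    (\<forall>x. \<pi> (t + N * read_bits x (Suc t)) = read_index N x (Suc t))"
proof -
  let ?A = "{t + N * read_bits x (Suc t) | x. True}"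
  let ?g = "\<lambda>k. Suc t mod N + 2 * N * (k div N)"
  have g: "?g (t + N * read_bits x (Suc t)) = read_index N x (Suc t)" for x
    using assms by (simp add: read_index_def)
  have lt: "read_index N x (Suc t) < 2 * N * 2 ^ N" for x
    using assms by (intro read_index_less) auto
  have inj: "inj_on ?g ?A"
  proof (rule inj_onI)
    fix k l assume "k \<in> ?A" "l \<in> ?A" and eq: "?g k = ?g l"
    then obtain a b where "k = t + N * a" "l = t + N * b" by blast
    with eq assms show "k = l" by simp
  qed
  have sub: "?A \<subseteq> {..<2 * N * 2 ^ N}"
  proof
    fix k assume "k \<in> ?A"
    then obtain x where k: "k = flip_index N x (read_index N x t)"
      using flip_read_index[OF assms] by auto
    show "k \<in> {..<2 * N * 2 ^ N}"
      unfolding k lessThan_iff using assms by (intro flip_index_less read_index_less) auto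
  qed
  have img: "?g ` ?A \<subseteq> {..<2 * N * 2 ^ N}"
    using lt by (simp only: image_subset_iff, clarify, simp only: g lessThan_iff)
  from ex_bij_betw_extending[OF inj sub img]
  obtain \<pi> where "bij_betw \<pi> {..<2 * N * 2 ^ N} {..<2 * N * 2 ^ N}" "\<forall>k\<in>?A. \<pi> k = ?g k"
    by (elim exE conjE)
  moreover from this(2) have "\<pi> (t + N * read_bits x (Suc t)) = read_index N x (Suc t)" for x
    unfolding g[symmetric] by blast
  ultimately show ?thesis by blast
qed

text \<open>Induction on the number \<open>d\<close> of queries left. Since \<open>run\<close>
  applies a unitary before each query, the claim starts from a basis state \<open>k\<close> that the
  permutation at time \<open>t\<close> still has to map to \<open>read_index N x t\<close>.\<close>

lemma run_perm_mats:
  assumes "N > 0" and D: "D = 2 * N * 2 ^ N"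
    and \<pi>: "\<And>t. t < N \<Longrightarrow> \<pi> (Suc t) (t + N * read_bits x (Suc t)) = read_index N x (Suc t)"
  shows "t + d = N \<Longrightarrow> k < D \<Longrightarrow> \<pi> t k = read_index N x t \<Longrightarrow>
    run N D x (map (\<lambda>t. perm_mat (\<pi> t)) [t..<Suc N]) (basis_state k) = basis_state (read_index N x N)"
proof (induction d arbitrary: t k)
  case 0
  then show ?case by (simp add: apply_perm_mat_basis_state)
next
  case (Suc d)
  then have "t < N" by simp
  then have "[t..<Suc N] = t # Suc t # [Suc (Suc t)..<Suc N]" "[Suc t..<Suc N] = Suc t # [Suc (Suc t)..<Suc N]"
    by (simp_all add: upt_conv_Cons del: upt_Suc)
  moreover have "flip_index N x (read_index N x t) < D"
    unfolding D using \<open>t < N\<close> by (intro flip_index_less read_index_less) auto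
  ultimately show ?case
    using Suc.IH[of "Suc t" "flip_index N x (read_index N x t)"] Suc.prems \<pi>[OF \<open>t < N\<close>] \<open>t < N\<close>
    by (simp add: apply_perm_mat_basis_state query_op_basis_state[OF \<open>N > 0\<close>] flip_read_index del: upt_Suc read_bits.simps)
qed

lemma ex_bounded_error_alg:
  assumes "N > 0" and f: "\<And>x y. (\<And>i. i < N \<Longrightarrow> x i = y i) \<Longrightarrow> f x = f y"
  shows "bounded_error_alg N f N"
proof -
  define D where "D = 2 * N * 2 ^ N"
  have "\<exists>\<pi>. bij_betw \<pi> {..<D} {..<D} \<and> (\<forall>x. \<pi> (t + N * read_bits x (Suc t)) = read_index N x (Suc t))"
    if "t < N" for t
    using ex_shift_bij[OF that] by (simp add: D_def)
  then obtain \<sigma> where \<sigma>: "\<And>t. t < N \<Longrightarrow> bij_betw (\<sigma> t) {..<D} {..<D}"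
    "\<And>t x. t < N \<Longrightarrow> \<sigma> t (t + N * read_bits x (Suc t)) = read_index N x (Suc t)"
    by metis
  \<comment> \<open>Nothing needs to be done before the first query, since \<open>init_state\<close>
    is already the basis state with index \<open>read_index N x 0 = 0\<close>.\<close>
  define \<pi> where "\<pi> t = (case t of 0 \<Rightarrow> id | Suc t \<Rightarrow> \<sigma> t)" for t
  define Us where "Us = map (\<lambda>t. perm_mat (\<pi> t)) [0..<Suc N]"
  define A where "A = {read_index N x N | x. f x}"
  have bij: "bij_betw (\<pi> t) {..<D} {..<D}" if "t \<le> N" for t
    using that \<sigma>(1) by (cases t) (auto simp: \<pi>_def)
  have "D > 0" using assms(1) by (simp add: D_def)
  have init: "init_state = basis_state 0" by (simp add: init_state_def basis_state_def)
  have run: "run N D x Us init_state = basis_state (read_index N x N)" for x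
    unfolding Us_def init
    by (rule run_perm_mats[OF assms(1) D_def, where d = N])
       (use \<open>D > 0\<close> \<sigma>(2) in \<open>simp_all add: \<pi>_def read_index_def del: read_bits.simps(2)\<close>)
  \<comment> \<open>The final index determines all \<open>N\<close> bits, so acceptance is decided
    without error.\<close>
  have A: "read_index N x N \<in> A \<longleftrightarrow> f x" for x
  proof
    assume "read_index N x N \<in> A"
    then obtain y where "f y" "read_index N x N = read_index N y N" by (auto simp: A_def)
    then have "read_bits x N = read_bits y N" using assms(1) by (simp add: read_index_def)
    then have "f x = f y" by (intro f) (rule read_bits_inject)
    with \<open>f y\<close> show "f x" by simp
  qed (auto simp: A_def)
  have "A \<subseteq> {..<D}" using read_index_less[OF assms(1), of N] by (auto simp: A_def D_def)
  then have "finite A" using finite_subset by blast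
  have "accept_prob N (2 ^ N) Us A x = (\<Sum>k\<in>A. if k = read_index N x N then 1 else 0)" for x
    unfolding accept_prob_def D_def[symmetric] run by (rule sum.cong) (auto simp: basis_state_def)
  then have "accept_prob N (2 ^ N) Us A x = (if f x then 1 else 0)" for x
    using \<open>finite A\<close> A by simp
  moreover have "\<forall>U\<in>set Us. unitary D U"
    using bij by (auto simp: Us_def intro!: unitary_perm_mat simp del: upt_Suc)
  moreover have "length Us = Suc N" by (simp add: Us_def)
  ultimately show ?thesis
    using \<open>A \<subseteq> {..<D}\<close> unfolding bounded_error_alg_def D_def
    by (intro exI[of _ "2 ^ N"] conjI exI[of _ Us] exI[of _ A]) auto
qed

section \<open>Attainment of the minimum in \<open>Q\<close>\<close>

lemma feval_cong: "(\<And>i. i \<in> fvars F \<Longrightarrow> x i = y i) \<Longrightarrow> feval F x = feval F y"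
proof (induction F)
  case (AndF fs)
  then have "feval g x = feval g y" if "g \<in> set fs" for g using that by simp blast
  then show ?case by simp
next
  case (OrF fs)
  then have "feval g x = feval g y" if "g \<in> set fs" for g using that by simp blast
  then show ?case by simp
qed simp

text \<open>A \<open>LEAST\<close> is informative only if some number qualifies. Reading all
  \<open>N\<close> variables provides one, so bounds valid for every algorithm carry over to
  \<open>Q\<close>.\<close>

lemma bounded_error_alg_Q:
  assumes "N > 0" "fvars F \<subseteq> {..<N}"
  shows "bounded_error_alg N (feval F) (Q N (feval F))"
  unfolding Q_def
  by (rule LeastI[of _ N], rule ex_bounded_error_alg[OF assms(1)], rule feval_cong) (use assms in auto)

subsection \<open>Formulas\<close>

definition and_formula :: "nat \<Rightarrow> form" where
  "and_formula P = AndF (map (\<lambda>i. Lit i True) [0..<P])"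

lemma feval_and_formula: "feval (and_formula P) x \<longleftrightarrow> (\<forall>i<P. x i)"
  by (auto simp: and_formula_def)

lemma fdepth_AndF_le: "(\<And>g. g \<in> set fs \<Longrightarrow> fdepth g \<le> d) \<Longrightarrow> fdepth (AndF fs) \<le> Suc d"
  by (simp flip: Max.set_eq_fold)

lemma fdepth_OrF_le: "(\<And>g. g \<in> set fs \<Longrightarrow> fdepth g \<le> d) \<Longrightarrow> fdepth (OrF fs) \<le> Suc d"
  by (simp flip: Max.set_eq_fold)

lemma and_formula_params:
  "fvars (and_formula P) = {..<P}" "fdepth (and_formula P) \<le> 1" "fsize (and_formula P) = P"
  "fgates (and_formula P) = 1"
proof -
  show "fdepth (and_formula P) \<le> 1"
    unfolding and_formula_def One_nat_def by (rule fdepth_AndF_le) auto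
qed (auto simp: and_formula_def comp_def sum_list_triv)

text \<open>The search lower bound: the all-ones input is related to the \<open>P\<close> inputs
  with a single 0 among the first \<open>P\<close> variables. This gives fibre sizes
  \<open>P\<close> and 1, and each variable tells at most one pair apart.\<close>

lemma sqrt_le_Q_and_formula:
  assumes "0 < P" "P \<le> N"
  shows "sqrt (real P) \<le> 36 * real (Q N (feval (and_formula P)))"
proof -
  let ?f = "feval (and_formula P)"
  have "sqrt (real P * real 1 / real 1) \<le> 36 * real (Q N ?f)"
  proof (rule adversary_bound[where R = "{..<P}" and px = "\<lambda>_. ()" and py = id
        and ix = "\<lambda>_ _. True" and iy = "\<lambda>r q. q \<noteq> r" and f = ?f and N = N])
    show "bounded_error_alg N ?f (Q N ?f)"
      using assms by (intro bounded_error_alg_Q) (simp_all add: and_formula_params)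
    show "1 \<le> card {r' \<in> {..<P}. id r' = id r}" if "r \<in> {..<P}" for r
      using that card_mono[of "{r' \<in> {..<P}. id r' = id r}" "{r}"] by simp
    show "card {r' \<in> {..<P}. () = () \<and> True \<noteq> (q \<noteq> id r')} *
        card {r' \<in> {..<P}. id r' = id r \<and> True \<noteq> (q \<noteq> id r')} \<le> 1" for r q
      using mult_le_mono[OF card_mono[of "{q}" "{r' \<in> {..<P}. () = () \<and> True \<noteq> (q \<noteq> id r')}"]
        card_mono[of "{q}" "{r' \<in> {..<P}. id r' = id r \<and> True \<noteq> (q \<noteq> id r')}"]] by auto
  qed (use assms in \<open>auto simp: feval_and_formula\<close>)
  then show ?thesis by simp
qed

section \<open>Code words and addresses of variables\<close>

definition code_list :: "nat \<Rightarrow> nat \<Rightarrow> nat list" where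
  "code_list B v = map (\<lambda>b. 2 * b + of_bool (bit v b)) [0..<B]"

lemma code_list_less: "j \<in> set (code_list B v) \<Longrightarrow> j < 2 * B"
  by (auto simp: code_list_def of_bool_def split: if_splits)

lemma not_bit_of_less: "v < 2 ^ B \<Longrightarrow> B \<le> b \<Longrightarrow> \<not> bit (v :: nat) b"
  by (metis bit_take_bit_iff leD take_bit_nat_eq_self)

text \<open>Of each pair \<open>2 * b\<close> and \<open>2 * b + 1\<close> a code word contains
  exactly one, so inclusion forces the same choice for every \<open>b\<close>. Inclusion is all that
  a conjunction of positive literals can test.\<close>

lemma code_list_subset_imp_eq:
  assumes "set (code_list B u) \<subseteq> set (code_list B v)" "u < 2 ^ B" "v < 2 ^ B"
  shows "u = v"
proof (rule bit_eqI)
  fix b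
  show "bit u b = bit v b"
  proof (cases "b < B")
    case True
    then have "2 * b + of_bool (bit u b) \<in> set (code_list B u)"
      unfolding code_list_def set_map by (intro imageI) simp
    with assms(1) have "2 * b + of_bool (bit u b) \<in> set (code_list B v)" by blast
    then obtain b' where eq: "2 * b + of_bool (bit u b) = 2 * b' + (of_bool (bit v b') :: nat)"
      by (auto simp: code_list_def)
    have par: "bit u b = bit v b'"
      using arg_cong[OF eq, of even] by (cases "bit u b"; cases "bit v b'") simp_all
    with eq have "b = b'" by simp
    with par show ?thesis by simp
  qed (use assms not_bit_of_less in auto)
qed

definition var_index :: "nat \<Rightarrow> nat \<Rightarrow> nat \<Rightarrow> nat \<Rightarrow> nat \<Rightarrow> nat" where
  "var_index K B i k j = (i * K + k) * (2 * B) + j"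

lemma var_index_decode:
  assumes "k < K" "j < 2 * B"
  shows "var_index K B i k j mod (2 * B) = j" "var_index K B i k j div (2 * B) mod K = k"
    "var_index K B i k j div (2 * B) div K = i"
proof -
  have "var_index K B i k j div (2 * B) = i * K + k"
    using assms by (simp add: var_index_def)
  then show "var_index K B i k j div (2 * B) mod K = k" "var_index K B i k j div (2 * B) div K = i"
    using assms by simp_all
  show "var_index K B i k j mod (2 * B) = j" using assms by (simp add: var_index_def)
qed

lemma var_index_less:
  assumes "i < D" "k < K" "j < 2 * B"
  shows "var_index K B i k j < D * K * (2 * B)"
proof -
  have "Suc i * K \<le> D * K" using assms by (intro mult_le_mono1) simp
  then have "Suc (i * K + k) \<le> D * K" using assms by simp
  then have "Suc (i * K + k) * (2 * B) \<le> D * K * (2 * B)" by (rule mult_le_mono1)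
  with assms show ?thesis by (simp add: var_index_def)
qed

text \<open>Position \<open>i\<close> has \<open>K\<close> cells of \<open>2 * B\<close> bits. All bits are 1 except in one cell, which holds the
  code word of the label at \<open>i\<close>. Code words form an antichain, so the label is \<open>u\<close> iff the
  bits of the code word of \<open>u\<close> are 1 in all \<open>K\<close> cells; to learn the label one must find the cell.\<close>

definition presence_formula :: "nat \<Rightarrow> nat \<Rightarrow> nat \<Rightarrow> nat \<Rightarrow> form" where
  "presence_formula n D K B = AndF (map (\<lambda>u. OrF (map (\<lambda>i. AndF (map (\<lambda>(k, j). Lit (var_index K B i k j) True)
      (List.product [0..<K] (code_list B u)))) [0..<D])) [1..<Suc n])"

lemma fdepth_presence_formula: "fdepth (presence_formula n D K B) \<le> 3"
  unfolding presence_formula_def numeral_3_eq_3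
  by (rule fdepth_AndF_le, simp only: set_map, elim imageE, simp only:, rule fdepth_OrF_le,
      simp only: set_map, elim imageE, simp only:, rule fdepth_AndF_le) auto

lemma fsize_presence_formula: "fsize (presence_formula n D K B) = n * (D * (K * B))"
  by (simp add: presence_formula_def comp_def case_prod_beta sum_list_triv code_list_def del: upt_Suc)

lemma fgates_presence_formula: "fgates (presence_formula n D K B) = 1 + n * (1 + D)"
  by (simp add: presence_formula_def comp_def case_prod_beta sum_list_triv del: upt_Suc)

lemma fvars_presence_formula: "fvars (presence_formula n D K B) \<subseteq> {..<D * K * (2 * B)}"
  by (auto simp: presence_formula_def simp del: upt_Suc intro!: var_index_less dest!: code_list_less)

text \<open>Label 0 stands for an unlabelled position. It has a code word too, so labelled and
  unlabelled positions look alike outside the cell in use.\<close>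

definition cell_input :: "nat \<Rightarrow> nat \<Rightarrow> (nat \<Rightarrow> nat) \<times> (nat \<Rightarrow> nat) \<Rightarrow> nat \<Rightarrow> bool" where
  "cell_input K B = (\<lambda>(v, p) q. let i = q div (2 * B) div K in
     q div (2 * B) mod K = p i \<longrightarrow> q mod (2 * B) \<in> set (code_list B (v i)))"

lemma feval_presence_formula:
  assumes v: "\<And>i. i < D \<Longrightarrow> v i \<le> n" and p: "\<And>i. i < D \<Longrightarrow> p i < K" and "n < 2 ^ B"
  shows "feval (presence_formula n D K B) (cell_input K B (v, p)) \<longleftrightarrow> (\<forall>u\<in>{1..n}. \<exists>i<D. v i = u)"
proof -
  have "(\<forall>k<K. \<forall>j\<in>set (code_list B u). cell_input K B (v, p) (var_index K B i k j)) \<longleftrightarrow> v i = u"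
    if "i < D" "u \<in> {1..n}" for i u
  proof -
    have "(\<forall>k<K. \<forall>j\<in>set (code_list B u). cell_input K B (v, p) (var_index K B i k j))
        \<longleftrightarrow> set (code_list B u) \<subseteq> set (code_list B (v i))"
      using p[OF that(1)] code_list_less[of _ B u] var_index_decode[of _ K _ B i]
      by (auto simp: cell_input_def)
    also have "\<dots> \<longleftrightarrow> v i = u"
      using code_list_subset_imp_eq[of B u "v i"] v[OF that(1)] that(2) assms(3) by auto
    finally show ?thesis .
  qed
  note inner = this
  have Ball_lessThan: "(\<forall>k\<in>{..<K}. P k) \<longleftrightarrow> (\<forall>k<K. P k)" for P
    by auto
  have eval: "feval (presence_formula n D K B) x \<longleftrightarrow>
      (\<forall>u\<in>{1..n}. \<exists>i\<in>{..<D}. \<forall>k<K. \<forall>j\<in>set (code_list B u). x (var_index K B i k j))" for x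
    by (simp add: presence_formula_def atLeastLessThanSuc_atLeastAtMost atLeast0LessThan Ball_lessThan del: upt_Suc)
  have "feval (presence_formula n D K B) (cell_input K B (v, p)) \<longleftrightarrow> (\<forall>u\<in>{1..n}. \<exists>i\<in>{..<D}. v i = u)"
    unfolding eval by (intro ball_cong bex_cong refl inner) auto
  then show ?thesis by (simp add: Bex_def)
qed

subsection \<open>Query lower bound for the presence formula\<close>

definition marked :: "nat \<Rightarrow> (nat \<Rightarrow> nat) \<Rightarrow> nat set" where
  "marked D v = {i. i < D \<and> v i \<noteq> 0}"

lemma finite_marked [simp]: "finite (marked D v)"
  by (simp add: marked_def)

definition labellings :: "nat \<Rightarrow> nat \<Rightarrow> (nat \<Rightarrow> nat) set" where
  "labellings n D = {v \<in> {..<D} \<rightarrow>\<^sub>E {..n}. inj_on v (marked D v) \<and> card (marked D v) = n}"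

text \<open>An index \<open>((v, p), i, k)\<close> pairs the labelling \<open>v\<close>, stored in the cells \<open>p\<close>, with the one obtained
  by erasing the label at \<open>i\<close> and moving its cell to \<open>k\<close>. Without that move, the algorithm could find the
  change in the cell which it knows already.\<close>

definition erasures :: "nat \<Rightarrow> nat \<Rightarrow> nat \<Rightarrow> (((nat \<Rightarrow> nat) \<times> (nat \<Rightarrow> nat)) \<times> nat \<times> nat) set" where
  "erasures n D K = {((v, p), i, k). v \<in> labellings n D \<and> p \<in> {..<D} \<rightarrow>\<^sub>E {..<K} \<and>
     i \<in> marked D v \<and> k < K \<and> k \<noteq> p i}"

definition erased :: "((nat \<Rightarrow> nat) \<times> (nat \<Rightarrow> nat)) \<times> nat \<times> nat \<Rightarrow> (nat \<Rightarrow> nat) \<times> (nat \<Rightarrow> nat)" where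
  "erased = (\<lambda>((v, p), i, k). (v(i := 0), p(i := k)))"

lemma finite_erasures: "finite (erasures n D K)"
proof (rule finite_subset)
  show "erasures n D K \<subseteq> (({..<D} \<rightarrow>\<^sub>E {..n}) \<times> ({..<D} \<rightarrow>\<^sub>E {..<K})) \<times> {..<D} \<times> {..<K}"
    by (auto simp: erasures_def labellings_def marked_def)
qed (simp add: finite_PiE)

text \<open>Pigeonhole: \<open>n\<close> distinct nonzero labels, none above \<open>n\<close>, use
  up all of them.\<close>

lemma labellings_image:
  assumes "v \<in> labellings n D" shows "v ` marked D v = {1..n}"
proof (rule card_seteq)
  show "v ` marked D v \<subseteq> {1..n}"
    using assms by (fastforce simp: labellings_def marked_def PiE_iff Suc_le_eq)
  show "card {1..n} \<le> card (v ` marked D v)"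
    using assms by (simp add: labellings_def card_image)
qed simp

lemma marked_update: "i < D \<Longrightarrow> marked D (v(i := 0)) = marked D v - {i}"
  "i < D \<Longrightarrow> u \<noteq> 0 \<Longrightarrow> marked D (v(i := u)) = insert i (marked D v)"
  by (auto simp: marked_def)

text \<open>The erased label is the only one missing elsewhere, so the remaining labels determine
  it.\<close>

lemma labellings_erased_label_unique:
  assumes "v \<in> labellings n D" "v' \<in> labellings n D" "i \<in> marked D v" "i \<in> marked D v'"
    and "v(i := 0) = v'(i := 0)"
  shows "v = v'"
proof -
  have "v' j = v j" if "j \<noteq> i" for j
    using fun_cong[OF assms(5), of j] that by simp
  moreover have "v' i = v i"
  proof (rule ccontr)
    assume ne: "v' i \<noteq> v i"
    have "v i \<in> v' ` marked D v'"
      using labellings_image[OF assms(1)] labellings_image[OF assms(2)] assms(3) by blast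
    then obtain j where j: "j \<in> marked D v'" "v' j = v i" by auto
    with ne have "j \<noteq> i" by auto
    with calculation j assms(3) have "v j = v i" "j \<in> marked D v" by (auto simp: marked_def)
    with assms(1,3) \<open>j \<noteq> i\<close> show False by (auto simp: labellings_def dest: inj_onD)
  qed
  ultimately show ?thesis by (metis ext)
qed

text \<open>There are \<open>n\<close> positions to erase and, for each, \<open>K - 1\<close> new
  cells.\<close>

lemma card_same_original:
  assumes r: "r \<in> erasures n D K"
  shows "n * (K - 1) \<le> card {r' \<in> erasures n D K. fst r' = fst r}"
proof -
  obtain v p i k where r_eq: "r = ((v, p), i, k)" by (metis surj_pair)
  let ?S = "SIGMA i:marked D v. {..<K} - {p i}"
  have mem: "v \<in> labellings n D" "p \<in> {..<D} \<rightarrow>\<^sub>E {..<K}"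
    using r by (auto simp: erasures_def r_eq)
  have "card ({..<K} - {p i}) = K - 1" if "i \<in> marked D v" for i
  proof -
    have "p i < K" using that mem(2) by (auto simp: marked_def PiE_iff)
    then show ?thesis by simp
  qed
  moreover have "card (marked D v) = n"
    using mem(1) by (simp add: labellings_def)
  ultimately have "n * (K - 1) = card ?S" by simp
  also have "\<dots> = card (Pair (v, p) ` ?S)"
    by (rule card_image[symmetric], rule inj_onI) (erule Pair_inject)
  also have "\<dots> \<le> card {r' \<in> erasures n D K. fst r' = fst r}"
  proof (rule card_mono)
    show "finite {r' \<in> erasures n D K. fst r' = fst r}"
      using finite_erasures by (rule finite_subset[rotated]) auto
    show "Pair (v, p) ` ?S \<subseteq> {r' \<in> erasures n D K. fst r' = fst r}"
    proof (rule image_subsetI)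
      fix s assume "s \<in> ?S"
      then obtain j l where "s = (j, l)" "j \<in> marked D v" "l < K" "l \<noteq> p j" by auto
      with mem show "((v, p), s) \<in> {r' \<in> erasures n D K. fst r' = fst r}"
        by (simp add: erasures_def r_eq)
    qed
  qed
  finally show ?thesis .
qed

text \<open>An erased labelling has \<open>n - 1\<close> labels, so \<open>2 * n - 1\<close>
  positions leave exactly \<open>n\<close> places for the missing label, each with
  \<open>K - 1\<close> possible former cells. This matches the count on the other side.\<close>

lemma card_same_erased:
  assumes r: "r \<in> erasures n D K" and D: "D = 2 * n - 1"
  shows "n * (K - 1) \<le> card {r' \<in> erasures n D K. erased r' = erased r}"
proof -
  obtain v p i k where r_eq: "r = ((v, p), i, k)" by (metis surj_pair)
  have mem: "v \<in> labellings n D" "p \<in> {..<D} \<rightarrow>\<^sub>E {..<K}" "i \<in> marked D v" "k < K"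
    using r by (auto simp: erasures_def r_eq)
  then have "i < D" "v i \<noteq> 0" "v i \<le> n" by (auto simp: marked_def labellings_def PiE_iff)
  then have "n > 0" by simp
  define w where "w = v(i := 0)"
  define p' where "p' = p(i := k)"
  let ?S = "SIGMA j:{..<D} - marked D w. {..<K} - {p' j}"
  \<comment> \<open>The missing label returns to position \<open>j\<close> in cell \<open>l\<close>.
    The last component is \<open>p' j\<close>, so that erasing restores \<open>p'\<close>.\<close>
  let ?g = "\<lambda>(j, l). ((w(j := v i), p'(j := l)), j, p' j)"
  have p': "p' \<in> {..<D} \<rightarrow>\<^sub>E {..<K}"
    using mem \<open>i < D\<close> by (auto simp: p'_def PiE_iff extensional_def)
  have "marked D w = marked D v - {i}" unfolding w_def by (rule marked_update(1)[OF \<open>i < D\<close>])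
  then have card_w: "card (marked D w) = n - 1"
    using mem by (simp add: labellings_def)
  have "marked D w \<subseteq> {..<D}" by (auto simp: marked_def)
  then have "card ({..<D} - marked D w) = n"
    using card_w \<open>n > 0\<close> by (simp add: card_Diff_subset D)
  moreover have "card ({..<K} - {p' j}) = K - 1" if "j < D" for j
  proof -
    have "p' j < K" using that p' by (auto simp: PiE_iff)
    then show ?thesis by simp
  qed
  ultimately have "n * (K - 1) = card ?S"
    by simp
  also have "\<dots> = card (?g ` ?S)"
  proof (rule card_image[symmetric], rule inj_onI)
    fix s t assume "?g s = ?g t"
    then have "fst s = fst t" "p'(fst s := snd s) = p'(fst s := snd t)" by (auto simp: case_prod_beta)
    then show "s = t" by (intro prod_eqI) (simp_all add: fun_upd_eqD)
  qed
  also have "\<dots> \<le> card {r' \<in> erasures n D K. erased r' = erased r}"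
  proof (rule card_mono)
    show "finite {r' \<in> erasures n D K. erased r' = erased r}"
      using finite_erasures by (rule finite_subset[rotated]) auto
    have g_mem: "?g (j, l) \<in> {r' \<in> erasures n D K. erased r' = erased r}"
      if j: "j < D" "j \<notin> marked D w" and l: "l < K" "l \<noteq> p' j" for j l
    proof -
      have "w j = 0" using j by (simp add: marked_def)
      have marked: "marked D (w(j := v i)) = insert j (marked D w)"
        by (rule marked_update(2)[OF j(1) \<open>v i \<noteq> 0\<close>])
      have "v i \<notin> w ` marked D w"
      proof
        assume "v i \<in> w ` marked D w"
        then obtain l where "l \<in> marked D w" "w l = v i" by auto
        then have "l \<noteq> i" "l \<in> marked D v" "v l = v i"
          by (auto simp: w_def marked_def split: if_splits)
        with mem(1,3) show False by (auto simp: labellings_def dest: inj_onD)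
      qed
      moreover have "inj_on w (marked D w)"
        using mem(1) by (auto simp: w_def labellings_def marked_def inj_on_def)
      ultimately have "inj_on (w(j := v i)) (insert j (marked D w))"
        using j(2) by (simp add: inj_on_fun_updI image_def)
      moreover have "w(j := v i) \<in> {..<D} \<rightarrow>\<^sub>E {..n}"
        using mem(1) \<open>i < D\<close> \<open>v i \<le> n\<close> j by (auto simp: w_def labellings_def PiE_iff extensional_def)
      ultimately have "w(j := v i) \<in> labellings n D"
        using j(2) card_w \<open>n > 0\<close> by (simp add: labellings_def marked)
      moreover have "p'(j := l) \<in> {..<D} \<rightarrow>\<^sub>E {..<K}"
        using p' j l by (auto simp: PiE_iff extensional_def)
      moreover have "p' j < K" using p' j by (auto simp: PiE_iff)
      ultimately have "?g (j, l) \<in> erasures n D K"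
        using l \<open>v i \<noteq> 0\<close> j by (simp add: erasures_def marked_def)
      moreover have "erased (?g (j, l)) = erased r"
        using \<open>w j = 0\<close> by (simp add: erased_def r_eq fun_upd_idem flip: w_def p'_def)
      ultimately show ?thesis by simp
    qed
    show "?g ` ?S \<subseteq> {r' \<in> erasures n D K. erased r' = erased r}"
    proof (rule image_subsetI)
      fix s assume "s \<in> ?S"
      then obtain j l where s: "s = (j, l)" and jl: "j < D" "j \<notin> marked D w" "l < K" "l \<noteq> p' j"
        by auto
      show "?g s \<in> {r' \<in> erasures n D K. erased r' = erased r}"
        unfolding s by (rule g_mem[OF jl])
    qed
  qed
  finally show ?thesis .
qed

text \<open>Labels and cells change only at the erased position, and there every cell other than the
  old and the new one is all ones in both inputs.\<close>

lemma cell_input_erasure_differ: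
  assumes differ: "cell_input K B (fst r) q \<noteq> cell_input K B (erased r) q"
  shows "fst (snd r) = q div (2 * B) div K"
    "q div (2 * B) mod K = snd (fst r) (q div (2 * B) div K) \<or> q div (2 * B) mod K = snd (snd r)"
proof -
  obtain v p i k where r_eq: "r = ((v, p), i, k)" by (metis surj_pair)
  define j c l where "j = q div (2 * B) div K" and "c = q div (2 * B) mod K" and "l = q mod (2 * B)"
  have ne: "(c = p j \<longrightarrow> l \<in> set (code_list B (v j))) \<noteq>
      (c = (p(i := k)) j \<longrightarrow> l \<in> set (code_list B ((v(i := 0)) j)))"
    using differ unfolding cell_input_def erased_def r_eq j_def c_def l_def Let_def by simp
  then have "i = j" by (cases "i = j") simp_all
  moreover from this ne have "c = p j \<or> c = k" by auto
  ultimately show "fst (snd r) = q div (2 * B) div K"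
      "q div (2 * B) mod K = snd (fst r) (q div (2 * B) div K) \<or> q div (2 * B) mod K = snd (snd r)"
    unfolding r_eq j_def c_def by simp_all
qed

text \<open>The queried variable fixes the position, and its cell \<open>c\<close> is the old or the
  new one. If \<open>c\<close> is the new cell, the original input has only one partner, as the new
  cell is known to be \<open>c\<close>; if \<open>c\<close> is the old cell, the erased input has
  only one. The other count is at most \<open>K - 1\<close>, so the product is \<open>K - 1\<close>
  instead of its square.\<close>

lemma card_differ_le:
  assumes r: "r \<in> erasures n D K"
    and differ: "cell_input K B (fst r) q \<noteq> cell_input K B (erased r) q"
  shows "card {r' \<in> erasures n D K. fst r' = fst r \<and>
        cell_input K B (fst r') q \<noteq> cell_input K B (erased r') q} *
      card {r' \<in> erasures n D K. erased r' = erased r \<and>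
        cell_input K B (fst r') q \<noteq> cell_input K B (erased r') q} \<le> K - 1"
    (is "card ?X * card ?Y \<le> _")
proof -
  obtain v p i k where r_eq: "r = ((v, p), i, k)" by (metis surj_pair)
  define c where "c = q div (2 * B) mod K"
  have mem: "v \<in> labellings n D" "p \<in> {..<D} \<rightarrow>\<^sub>E {..<K}" "i \<in> marked D v" "k < K" "k \<noteq> p i"
    using r by (auto simp: erasures_def r_eq)
  have i: "i = q div (2 * B) div K" and c: "c = p i \<or> c = k"
    using cell_input_erasure_differ[OF differ] by (auto simp: r_eq c_def)
  have "p i < K" using mem by (auto simp: PiE_iff marked_def)
  have X: "\<exists>k'. r' = ((v, p), i, k') \<and> k' < K \<and> k' \<noteq> p i \<and> (c = p i \<or> c = k')" if "r' \<in> ?X" for r'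
    using that cell_input_erasure_differ[of K B r' q]
    by (cases r') (auto simp: r_eq i[symmetric] c_def[symmetric] erasures_def)
  have Y: "\<exists>l. r' = ((v, p(i := l)), i, k) \<and> l < K \<and> l \<noteq> k \<and> (c = l \<or> c = k)" if "r' \<in> ?Y" for r'
  proof -
    obtain v' p' i' k' where r'_eq: "r' = ((v', p'), i', k')" by (metis surj_pair)
    have r': "r' \<in> erasures n D K" and e: "erased r' = erased r"
      and d: "cell_input K B (fst r') q \<noteq> cell_input K B (erased r') q"
      using that by auto
    have "i' = i" "c = p' i \<or> c = k'"
      using cell_input_erasure_differ[OF d] by (auto simp: r'_eq i[symmetric] c_def[symmetric])
    then have e': "v'(i := 0) = v(i := 0)" "p'(i := k') = p(i := k)"
      using e by (auto simp: erased_def r_eq r'_eq)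
    have mem': "v' \<in> labellings n D" "p' \<in> {..<D} \<rightarrow>\<^sub>E {..<K}" "i \<in> marked D v'" "k' \<noteq> p' i"
      using r' \<open>i' = i\<close> by (auto simp: erasures_def r'_eq)
    have "v' = v" using labellings_erased_label_unique[OF mem'(1) mem(1) mem'(3) mem(3) e'(1)] .
    moreover have "k' = k" using fun_cong[OF e'(2), of i] by simp
    moreover have "p' = p(i := p' i)" using e'(2) by (metis fun_upd_triv fun_upd_upd)
    moreover have "p' i < K" using mem' by (auto simp: PiE_iff marked_def)
    ultimately show ?thesis
      using \<open>c = p' i \<or> c = k'\<close> mem'(4) \<open>i' = i\<close> unfolding r'_eq by blast
  qed
  show ?thesis
  proof (cases "c = k")
    case True
    have "r' = ((v, p), i, k)" if "r' \<in> ?X" for r'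
      using X[OF that] True mem(5) by auto
    then have "card ?X \<le> card {((v, p), i, k)}"
      by (intro card_mono) auto
    moreover have "card ?Y \<le> card ((\<lambda>l. ((v, p(i := l)), i, k)) ` ({..<K} - {k}))"
      by (rule card_mono) (simp, rule subsetI, drule Y, blast)
    moreover have "\<dots> \<le> card ({..<K} - {k})" by (rule card_image_le) simp
    ultimately show ?thesis using mult_le_mono[of "card ?X" 1 "card ?Y" "K - 1"] \<open>k < K\<close> by simp
  next
    case False
    with c have "c = p i" by simp
    have "r' = ((v, p(i := c)), i, k)" if "r' \<in> ?Y" for r'
      using Y[OF that] False by auto
    then have "card ?Y \<le> card {((v, p(i := c)), i, k)}"
      by (intro card_mono) auto
    moreover have "card ?X \<le> card ((\<lambda>k'. ((v, p), i, k')) ` ({..<K} - {p i}))"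
      by (rule card_mono) (simp, rule subsetI, drule X, blast)
    moreover have "\<dots> \<le> card ({..<K} - {p i})" by (rule card_image_le) simp
    ultimately show ?thesis using mult_le_mono[of "card ?X" "K - 1" "card ?Y" 1] \<open>p i < K\<close> by simp
  qed
qed

lemma sqrt_le_Q_presence_formula:
  assumes n: "0 < n" "n < 2 ^ B" and K: "2 \<le> K" and D: "D = 2 * n - 1" and N: "D * K * (2 * B) \<le> N"
  shows "real n * sqrt (real (K - 1)) \<le> 36 * real (Q N (feval (presence_formula n D K B)))"
proof -
  let ?f = "feval (presence_formula n D K B)"
  have "B > 0" using n by (cases B) auto
  have "N > 0" using N n K D \<open>B > 0\<close> by (cases N) auto
  have "sqrt (real (n * (K - 1)) * real (n * (K - 1)) / real (K - 1)) \<le> 36 * real (Q N ?f)"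
  proof (rule adversary_bound[where R = "erasures n D K" and px = fst and py = erased
        and ix = "cell_input K B" and iy = "cell_input K B" and f = ?f and N = N])
    show "bounded_error_alg N ?f (Q N ?f)"
      using N \<open>N > 0\<close> fvars_presence_formula[of n D K B] by (intro bounded_error_alg_Q) auto
    \<comment> \<open>A sample pair: labels 1 to \<open>n\<close> on the first \<open>n\<close>
      positions, all cells 0; position 0 is erased and its cell moved to 1, which exists by
      \<open>2 \<le> K\<close>.\<close>
    define v where "v = restrict (\<lambda>i. if i < n then Suc i else 0) {..<D}"
    have "marked D v = {..<n}" using n by (auto simp: marked_def v_def D)
    moreover have "v \<in> {..<D} \<rightarrow>\<^sub>E {..n}" by (auto simp: v_def)
    moreover have "inj_on v {..<n}" using D by (auto simp: v_def inj_on_def)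
    ultimately have "((v, restrict (\<lambda>_. 0) {..<D}), 0, 1) \<in> erasures n D K"
      using n K D by (auto simp: erasures_def labellings_def)
    then show "erasures n D K \<noteq> {}" by blast
    show "?f (cell_input K B (fst r))" "\<not> ?f (cell_input K B (erased r))" if r: "r \<in> erasures n D K" for r
    proof -
      obtain v p i k where r_eq: "r = ((v, p), i, k)" by (metis surj_pair)
      have mem: "v \<in> labellings n D" "p \<in> {..<D} \<rightarrow>\<^sub>E {..<K}" "i \<in> marked D v" "k < K"
        using r by (auto simp: erasures_def r_eq)
      have v: "v j \<le> n" and p: "p j < K" if "j < D" for j
        using mem that by (auto simp: labellings_def PiE_iff)
      have "\<exists>j<D. v j = u" if "u \<in> {1..n}" for u
        using that unfolding labellings_image[OF mem(1), symmetric] by (auto simp: marked_def)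
      then show "?f (cell_input K B (fst r))"
        unfolding r_eq fst_conv using feval_presence_formula[of D v n p K B] v p n by blast
      have "v i \<in> {1..n}" using mem v by (auto simp: marked_def)
      moreover have "(v(i := 0)) j \<noteq> v i" if "j < D" for j
      proof
        assume eq: "(v(i := 0)) j = v i"
        then have "j \<noteq> i" "v j = v i" using mem(3) by (auto simp: marked_def split: if_splits)
        moreover from this have "j \<in> marked D v" using that mem(3) by (simp add: marked_def)
        ultimately show False using mem(1,3) by (auto simp: labellings_def dest: inj_onD)
      qed
      ultimately have "\<not> (\<forall>u\<in>{1..n}. \<exists>j<D. (v(i := 0)) j = u)" by blast
      moreover have "?f (cell_input K B (v(i := 0), p(i := k))) \<longleftrightarrow> (\<forall>u\<in>{1..n}. \<exists>j<D. (v(i := 0)) j = u)"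
        by (rule feval_presence_formula) (use v p mem n in auto)
      ultimately show "\<not> ?f (cell_input K B (erased r))"
        by (simp add: r_eq erased_def)
    qed
  qed (use n K D \<open>N > 0\<close> finite_erasures card_same_original card_same_erased card_differ_le in auto)
  moreover have "real (n * (K - 1)) * real (n * (K - 1)) / real (K - 1) = (real n)\<^sup>2 * real (K - 1)"
    using K by (simp add: power2_eq_square field_simps)
  ultimately show ?thesis by (simp only: real_sqrt_mult real_sqrt_abs abs_of_nat)
qed

subsection \<open>Choice of parameters\<close>

lemma ex_formula_large_Q:
  fixes N S G B :: nat
  defines "t \<equiv> min (real N) (min (sqrt (real S)) (sqrt (real N) * real G powr (1/4)))"
  assumes pos: "N \<ge> 1" "S \<ge> 1" "G \<ge> 1" "B \<ge> 1" and NB: "N < 2 ^ B"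
  shows "\<exists>F. fvars F \<subseteq> {..<N} \<and> fdepth F \<le> 3 \<and> fsize F \<le> S \<and> fgates F \<le> G \<and>
    t \<le> 720 * real B * real (Q N (feval F))"
\<comment> \<open>These are exactly the cases in which the \<open>r\<close> defined below is less
  than 1, so that no \<open>n \<ge> 1\<close> is available.\<close>
proof (cases "G < 4 \<or> S < N \<or> N < 8 * B")
  case True
  define P where "P = min N S"
  have P: "0 < P" "P \<le> N" "P \<le> S" using pos by (auto simp: P_def)
  have "t \<le> 8 * real B * sqrt (real P)"
  proof (cases "S < N")
    case True
    then have "t \<le> 1 * sqrt (real P)" by (simp add: t_def P_def)
    also have "\<dots> \<le> (8 * real B) * sqrt (real P)" using pos by (intro mult_right_mono) auto
    finally show ?thesis .
  next
    case False
    then have "P = N" by (simp add: P_def)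
    consider "G < 4" | "N < 8 * B" using \<open>G < 4 \<or> S < N \<or> N < 8 * B\<close> False by blast
    then show ?thesis
    proof cases
      case 1
      have "real G powr (1/4) \<le> real G powr 1" using pos by (intro powr_mono) auto
      also have "\<dots> \<le> 8 * real B" using 1 pos by simp
      finally have "sqrt (real N) * real G powr (1/4) \<le> sqrt (real N) * (8 * real B)"
        by (intro mult_left_mono) auto
      then show ?thesis by (simp add: t_def \<open>P = N\<close> mult.commute min_le_iff_disj)
    next
      case 2
      have "sqrt (real N) \<le> real N" using pos by (intro real_le_lsqrt) (auto simp: power2_eq_square)
      also have "\<dots> \<le> 8 * real B" using 2 by linarith
      finally have "sqrt (real N) * sqrt (real N) \<le> 8 * real B * sqrt (real N)"
        by (intro mult_right_mono) auto
      then show ?thesis by (simp add: t_def \<open>P = N\<close> min_le_iff_disj)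
    qed
  qed
  also have "\<dots> \<le> 8 * real B * (36 * real (Q N (feval (and_formula P))))"
    using sqrt_le_Q_and_formula[OF P(1,2)] by (intro mult_left_mono) auto
  also have "\<dots> \<le> 720 * real B * real (Q N (feval (and_formula P)))" by simp
  finally show ?thesis
    using P pos and_formula_params[of P] by (intro exI[of _ "and_formula P"]) auto
next
  case False
  then have big: "G \<ge> 4" "S \<ge> N" "N \<ge> 8 * B" by auto
  \<comment> \<open>The first bound on \<open>n\<close> pays for the
    \<open>1 + 2 * n\<^sup>2\<close> gates, the second for the size, and the third leaves at least
    two cells per position.\<close>
  define r where "r = min (sqrt (real G) / 2) (min (real S / real N) (real N / (8 * real B)))"
  have "2 \<le> sqrt (real G)" using big by (intro real_le_rsqrt) auto
  then have "1 \<le> r" using big pos by (auto simp: r_def field_simps)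
  define n where "n = nat \<lfloor>r\<rfloor>"
  have n: "real n \<le> r" "r \<le> 2 * real n" "1 \<le> n"
  proof -
    have "1 \<le> \<lfloor>r\<rfloor>" using \<open>1 \<le> r\<close> by simp
    then have "real n = real_of_int \<lfloor>r\<rfloor>" by (simp add: n_def)
    then show "real n \<le> r" "r \<le> 2 * real n" using \<open>1 \<le> \<lfloor>r\<rfloor>\<close> by linarith+
    show "1 \<le> n" unfolding n_def using \<open>1 \<le> \<lfloor>r\<rfloor>\<close> by linarith
  qed
  have nG: "4 * n\<^sup>2 \<le> G"
  proof -
    have "(2 * real n)\<^sup>2 \<le> (sqrt (real G))\<^sup>2" using n(1) by (intro power_mono) (auto simp: r_def)
    then have "real (4 * n\<^sup>2) \<le> real G" by (simp add: power_mult_distrib)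
    then show ?thesis by (simp only: of_nat_le_iff)
  qed
  have nS: "n * N \<le> S"
  proof -
    have "real (n * N) \<le> real S" using n(1) pos by (simp add: r_def field_simps)
    then show ?thesis by (simp only: of_nat_le_iff)
  qed
  have nB: "8 * n * B \<le> N"
  proof -
    have "real (8 * n * B) \<le> real N" using n(1) pos by (simp add: r_def field_simps)
    then show ?thesis by (simp only: of_nat_le_iff)
  qed
  define D where "D = 2 * n - 1"
  \<comment> \<open>One cell at every position takes \<open>W\<close> variables in total;
    \<open>K\<close> is the largest number of cells that fits.\<close>
  define W where "W = D * (2 * B)"
  define K where "K = N div W"
  have "W \<ge> 1" using n(3) pos by (simp add: W_def D_def)
  have W: "W \<le> 4 * n * B" by (simp add: W_def D_def algebra_simps)
  then have "2 * W \<le> N" using nB by linarith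
  then have K: "2 \<le> K" using \<open>W \<ge> 1\<close> by (simp add: K_def less_eq_div_iff_mult_less_eq)
  have KW: "K * W \<le> N" by (simp add: K_def)
  then have DKB: "D * K * (2 * B) \<le> N" by (simp add: W_def mult_ac)
  let ?F = "presence_formula n D K B"
  have size: "fsize ?F \<le> S"
  proof -
    have "2 * fsize ?F = n * (D * K * (2 * B))" by (simp add: fsize_presence_formula)
    also have "\<dots> \<le> n * N" using DKB by (rule mult_le_mono2)
    finally show ?thesis using nS by linarith
  qed
  have gates: "fgates ?F \<le> G"
  proof -
    have "fgates ?F = 1 + 2 * n\<^sup>2"
      using n(3) by (simp add: fgates_presence_formula D_def power2_eq_square)
    also have "\<dots> \<le> 4 * n\<^sup>2" using n(3) by (simp add: Suc_le_eq)
    finally show ?thesis using nG by linarith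
  qed
  have "n < 2 ^ B"
  proof -
    have "n * 1 \<le> n * (8 * B)" using pos by (intro mult_le_mono) auto
    also have "\<dots> = 8 * n * B" by simp
    also note nB
    also note NB
    finally show ?thesis by simp
  qed
  then have lower: "real n * sqrt (real (K - 1)) \<le> 36 * real (Q N (feval ?F))"
    using n(3) K D_def DKB by (intro sqrt_le_Q_presence_formula) auto
  have N_le: "real N \<le> 12 * real n * real B * real (K - 1)"
  proof -
    have "N < Suc K * W" using dividend_less_div_times[of W N] \<open>W \<ge> 1\<close> by (simp add: K_def)
    \<comment> \<open>\<open>K + 1 \<le> 3 * (K - 1)\<close> holds because
      \<open>K \<ge> 2\<close>.\<close>
    also have "\<dots> \<le> (3 * (K - 1)) * (4 * n * B)" using K W by (intro mult_le_mono) auto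
    finally have "real N \<le> real ((3 * (K - 1)) * (4 * n * B))" by (simp only: of_nat_le_iff less_imp_le)
    then show ?thesis by (simp add: mult_ac)
  qed
  have "0 \<le> t" by (simp add: t_def)
  have t2: "t\<^sup>2 \<le> 16 * real B * (r * real N)"
  proof -
    have "t \<le> sqrt (real N) * real G powr (1/4)" "t \<le> sqrt (real S)" "t \<le> real N"
      by (simp_all add: t_def)
    note this[THEN power_mono, OF \<open>0 \<le> t\<close>, of 2]
    moreover have "(real G powr (1/4))\<^sup>2 = sqrt (real G)"
      by (simp add: power2_eq_square powr_half_sqrt flip: powr_add)
    ultimately have t: "t\<^sup>2 \<le> real N * sqrt (real G)" "t\<^sup>2 \<le> real S" "t\<^sup>2 \<le> (real N)\<^sup>2"
      by (simp_all add: power_mult_distrib)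
    have B1: "1 \<le> real B" using pos by simp
    \<comment> \<open>Whichever term attains the minimum \<open>r\<close>, the corresponding term of
      \<open>t\<close> gives the estimate.\<close>
    consider "r = sqrt (real G) / 2" | "r = real S / real N" | "r = real N / (8 * real B)"
      unfolding r_def min_def by presburger
    then show ?thesis
    proof cases
      case 1
      have "real N * sqrt (real G) \<le> (8 * real B) * (real N * sqrt (real G))"
        using mult_right_mono[of 1 "8 * real B" "real N * sqrt (real G)"] B1 by simp
      with t(1) show ?thesis unfolding 1 by (simp add: mult_ac)
    next
      case 2
      have "real S \<le> (16 * real B) * real S"
        using mult_right_mono[of 1 "16 * real B" "real S"] B1 by simp
      with t(2) have "t\<^sup>2 \<le> 16 * real B * real S" by (rule order_trans)
      then show ?thesis unfolding 2 using pos by simp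
    next
      case 3
      have "(real N)\<^sup>2 \<le> 2 * (real N)\<^sup>2" by simp
      with t(3) have "t\<^sup>2 \<le> 2 * (real N)\<^sup>2" by (rule order_trans)
      then show ?thesis unfolding 3 using pos by (simp add: power2_eq_square)
    qed
  qed
  also have "16 * real B * (r * real N) \<le> 16 * real B * ((2 * real n) * (12 * real n * real B * real (K - 1)))"
    using n(2) N_le \<open>1 \<le> r\<close> by (intro mult_left_mono mult_mono) auto
  \<comment> \<open>The constants give \<open>16 * 2 * 12 = 384\<close>, which is below
    \<open>20\<^sup>2\<close>.\<close>
  also have "\<dots> \<le> (20 * real B * (real n * sqrt (real (K - 1))))\<^sup>2"
    by (simp add: power_mult_distrib power2_eq_square mult_ac)
  finally have "t \<le> 20 * real B * (real n * sqrt (real (K - 1)))"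
    by (rule power2_le_imp_le) simp
  also have "\<dots> \<le> 20 * real B * (36 * real (Q N (feval ?F)))"
    using lower by (intro mult_left_mono) auto
  finally have "t \<le> 720 * real B * real (Q N (feval ?F))" by simp
  moreover have "fvars ?F \<subseteq> {..<N}" using fvars_presence_formula[of n D K B] DKB by auto
  ultimately show ?thesis using size gates fdepth_presence_formula by blast
qed

lemma ex_log_bound:
  assumes "N \<ge> 2"
  shows "\<exists>B\<ge>1. N < 2 ^ B \<and> real B \<le> 4 * ln (real N)"
proof (intro exI conjI)
  let ?l = "log 2 (real N)" and ?B = "Suc (nat \<lfloor>log 2 (real N)\<rfloor>)"
  have l: "1 \<le> ?l" using assms by simp
  have "real N = 2 powr ?l" using assms by simp
  also have "\<dots> < 2 powr real ?B" using l by (intro powr_less_mono) linarith+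
  also have "\<dots> = 2 ^ ?B" by (rule powr_realpow) simp
  finally have "real N < real (2 ^ ?B)" by simp
  then show "N < 2 ^ ?B" by (simp only: of_nat_less_iff)
  have "ln (1/2 :: real) \<le> 1/2 - 1" by (rule ln_le_minus_one) simp
  then have ln2: "1/2 \<le> ln (2::real)" by (simp add: ln_div)
  \<comment> \<open>Since the logarithm is at least 1, doubling it absorbs the successor;
    \<open>ln 2 \<ge> 1/2\<close> then gives the second factor 2.\<close>
  have "real ?B \<le> 2 * ?l" using l by linarith
  also have "\<dots> = 2 * ln (real N) / ln 2" by (simp add: log_def)
  also have "\<dots> \<le> 2 * ln (real N) / (1/2)" using ln2 assms by (intro divide_left_mono) auto
  finally show "real ?B \<le> 4 * ln (real N)" by simp
qed simp

theorem theorem4: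
  shows "\<exists>c::real. \<exists>a::real. c > 0 \<and> a \<ge> 0 \<and>
    (\<forall>N S G :: nat. N \<ge> 2 \<longrightarrow> S \<ge> 1 \<longrightarrow> G \<ge> 1 \<longrightarrow>
      (\<exists>F. fvars F \<subseteq> {..<N} \<and> fdepth F \<le> 3 \<and> fsize F \<le> S \<and> fgates F \<le> G \<and>
         real (Q N (feval F)) \<ge>
           c * min (real N) (min (sqrt (real S)) (sqrt (real N) * real G powr (1/4)))
             / (ln (real N)) powr a))"
proof (rule exI[of _ "1/2880"], rule exI[of _ 1], intro conjI allI impI)
  fix N S G :: nat
  assume N: "N \<ge> 2" and "S \<ge> 1" "G \<ge> 1"
  let ?t = "min (real N) (min (sqrt (real S)) (sqrt (real N) * real G powr (1/4)))"
  obtain B where B: "B \<ge> 1" "N < 2 ^ B" "real B \<le> 4 * ln (real N)"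
    using ex_log_bound[OF N] by blast
  obtain F where F: "fvars F \<subseteq> {..<N}" "fdepth F \<le> 3" "fsize F \<le> S" "fgates F \<le> G"
    and t: "?t \<le> 720 * real B * real (Q N (feval F))"
    using ex_formula_large_Q[of N S G B] N \<open>S \<ge> 1\<close> \<open>G \<ge> 1\<close> B by auto
  \<comment> \<open>The code length \<open>B\<close> is the only source of the logarithm, hence
    exponent 1; the constant is \<open>720 * 4 = 2880\<close>.\<close>
  note t
  also have "720 * real B * real (Q N (feval F)) \<le> 720 * (4 * ln (real N)) * real (Q N (feval F))"
    using B(3) by (intro mult_right_mono mult_left_mono) auto
  finally have "?t \<le> 2880 * ln (real N) * real (Q N (feval F))" by simp
  moreover have "ln (real N) > 0" using N by simp
  ultimately have "1/2880 * ?t / ln (real N) powr 1 \<le> real (Q N (feval F))"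
    by (simp add: divide_le_eq mult_ac)
  with F show "\<exists>F. fvars F \<subseteq> {..<N} \<and> fdepth F \<le> 3 \<and> fsize F \<le> S \<and> fgates F \<le> G \<and>
      real (Q N (feval F)) \<ge> 1/2880 * ?t / ln (real N) powr 1"
    by blast
qed simp_all

end
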